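(* The spectral curves associated to the characteristic polynomials of $D_1^N,\underline D_2^N,D_2^N,\underline D_1^N$ are pairwise equal. More precisely, as polynomials in $x$ and $y$, $$u_{d_1+1}\det\left[x\mathbf 1_{d_1+1}-D_2^N(y)\right]=v_{d_2+1}\det\left[y\mathbf 1_{d_2+1}-\underline D_1^N(x)\right]\qquad(N\ge d_1+1),$$ $$u_{d_1+1}\det\left[x\mathbf 1_{d_1+1}-\underline D_2^N(y)\right]=v_{d_2+1}\det\left[y\mathbf 1_{d_2+1}-D_1^N(x)\right]\qquad(N\ge d_2+1).$$
   Context: **Setting.** Fix integers $d_1,d_2\ge1$ and $V_1(x)=\sum_{K=1}^{d_1+1}\frac{u_K}{K}x^K$, $V_2(y)=\sum_{J=1}^{d_2+1}\frac{v_J}{J}y^J$ with $u_{d_1+1}\ne0$, $v_{d_2+1}\ne0$, and contours $\Gamma_x,\Gamma_y$ such that all integrals below converge and integrations by parts produce no boundary terms. Assume there are monic polynomials $\pi_n,\sigma_n$ of degree $n$ ($n\ge0$) with $\int_{\Gamma_x}\int_{\Gamma_y}\pi_n(x)\sigma_m(y)e^{-V_1(x)-V_2(y)+xy}\,dy\,dx=h_n\delta_{nm}$, $h_n\neq0$. Fix square roots $\sqrt{h_n}$ and put $\psi_n(x)=\pi_n(x)e^{-V_1(x)}/\sqrt{h_n}$. **Recursion coefficients.** There are unique numbers $\alpha_j(n)$ ($-1\le j\le d_2$), $\beta_j(n)$ ($-1\le j\le d_1$), with $\alpha_{-1}(n)=\beta_{-1}(n)=\gamma(n)=\sqrt{h_{n+1}}/\sqrt{h_n}$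 and $\alpha_j(n)=\beta_j(n)=0$ for $n<j$, such that for all $n\ge0$ (terms with negative index omitted) $x\psi_n=\sum_{j=-1}^{d_2}\alpha_j(n)\psi_{n-j}$ and $\partial_x\psi_n=-\sum_{j=-1}^{d_1}\beta_j(n+j)\psi_{n+j}$. Moreover $\alpha_{d_2}(n)=v_{d_2+1}\prod_{j=1}^{d_2}\gamma(n-j)\ne0$ ($n\ge d_2$) and $\beta_{d_1}(n)=u_{d_1+1}\prod_{j=1}^{d_1}\gamma(n-j)\neq0$ ($n\ge d_1$). **Ladder matrices.** $\mathbf a_N(x)$ ($N\ge d_2$) is the $(d_2+1)\times(d_2+1)$ matrix with $1$'s on the first superdiagonal, last row $\frac1{\gamma(N)}(-\alpha_{d_2}(N),\dots,-\alpha_1(N),x-\alpha_0(N))$, other entries $0$; $\mathbf b_N(y)$ ($N\ge d_1$) is the $(d_1+1)\times(d_1+1)$ matrix with $1$'s on the first superdiagonal, last row $\frac1{\gamma(N)}(-\beta_{d_1}(N),\dots,-\beta_1(N),y-\beta_0(N))$, other entries $0$. Write $\mathbf a^N=\mathbf a_N^{-1}$, $\mathbf b^N=\mathbf b_N^{-1}$. For $N\ge1$, $\underline{\mathbf a}^N(x)$ is the $(d_2+1)\times(d_2+1)$ matrix with $1$'s on the first superdiagonal, first column $\frac1{\gamma(N-1)}(x-\alpha_0(N),-\alpha_1(N+1),\dots,-\alpha_{d_2}(N+d_2))^t$, other entries $0$; $\underline{\mathbf b}^N(y)$ is the $(d_1+1)\times(d_1+1)$ matrix with $1$'s on the first superdiagonal,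 first column $\frac1{\gamma(N-1)}(y-\beta_0(N),-\beta_1(N+1),\dots,-\beta_{d_1}(N+d_1))^t$, other entries $0$. Write $\underline{\mathbf a}_N=(\underline{\mathbf a}^N)^{-1}$, $\underline{\mathbf b}_N=(\underline{\mathbf b}^N)^{-1}$ (all these inverses have polynomial entries). **Differential matrices.** For $j\ge-1$ put $\beta^N_j=\mathrm{diag}(\beta_j(N+j-d_2),\dots,\beta_j(N+j))$, $\alpha^N_j=\mathrm{diag}(\alpha_j(N+j-d_1),\dots,\alpha_j(N+j))$, $\underline\alpha^N_j=\mathrm{diag}(\alpha_j(N),\dots,\alpha_j(N+d_1))$, $\underline\beta^N_j=\mathrm{diag}(\beta_j(N),\dots,\beta_j(N+d_2))$. Then $D_1^N(x)=\beta^N_{-1}\mathbf a^{N-1}+\beta_0^N+\sum_{j=1}^{d_1}\beta_j^N\mathbf a_{N+j-1}\cdots\mathbf a_N$ ($N\ge d_2+1$), $D_2^N(y)=\alpha^N_{-1}\mathbf b^{N-1}+\alpha_0^N+\sum_{j=1}^{d_2}\alpha_j^N\mathbf b_{N+j-1}\cdots\mathbf b_N$ ($N\ge d_1+1$), $\underline D_2^N(y)=\underline{\mathbf b}_N\underline\alpha_{-1}^{N-1}+\underline\alpha_0^{N-1}+\sum_{j=1}^{d_2}\underline{\mathbf b}^{N-1}\cdots\underline{\mathbf b}^{N-j}\underline\alpha_j^{N-1}$ ($N\ge d_2+1$), $\underline D_1^N(x)=\underline{\mathbf a}_N\underline\beta_{-1}^{N-1}+\underline\beta_0^{N-1}+\sum_{j=1}^{d_1}\underline{\mathbf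 a}^{N-1}\cdots\underline{\mathbf a}^{N-j}\underline\beta_j^{N-1}$ ($N\ge d_1+1$). *)

theory Defs
  imports "HOL-Complex_Analysis.Contour_Integration" "Jordan_Normal_Form.Determinant"
begin

section \<open>The biorthogonality pairing\<close>

definition potential :: "nat \<Rightarrow> (nat \<Rightarrow> complex) \<Rightarrow> complex \<Rightarrow> complex" where
  "potential d u x = (\<Sum>K = 1..d + 1. u K / of_nat K * x ^ K)"

definition weight ::
  "nat \<Rightarrow> nat \<Rightarrow> (nat \<Rightarrow> complex) \<Rightarrow> (nat \<Rightarrow> complex) \<Rightarrow> complex \<Rightarrow> complex \<Rightarrow> complex" where
  "weight d1 d2 u v x y = exp (- potential d1 u x - potential d2 v y + x * y)"

text \<open>
  A contour is parametrised by the open unit interval, so that it may run to infinity at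
  either end. The library's contour integral is a gauge integral over the closed unit interval
  and therefore ignores the values at the two endpoints; it covers absolutely convergent as well
  as improper integrals along such contours.
\<close>

definition contour :: "(real \<Rightarrow> complex) \<Rightarrow> bool" where
  "contour \<Gamma> \<longleftrightarrow> \<Gamma> piecewise_C1_differentiable_on {0<..<1}"

definition iterated_integral ::
  "(real \<Rightarrow> complex) \<Rightarrow> (real \<Rightarrow> complex) \<Rightarrow> (complex \<Rightarrow> complex \<Rightarrow> complex) \<Rightarrow> complex" where
  "iterated_integral \<Gamma>x \<Gamma>y f = contour_integral \<Gamma>x (\<lambda>x. contour_integral \<Gamma>y (\<lambda>y. f x y))"

definition iterated_integrable ::
  "(real \<Rightarrow> complex) \<Rightarrow> (real \<Rightarrow> complex) \<Rightarrow> (complex \<Rightarrow> complex \<Rightarrow> complex) \<Rightarrow> bool" where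
  "iterated_integrable \<Gamma>x \<Gamma>y f \<longleftrightarrow>
     (\<forall>x \<in> \<Gamma>x ` {0<..<1}. (\<lambda>y. f x y) contour_integrable_on \<Gamma>y) \<and>
     (\<lambda>x. contour_integral \<Gamma>y (\<lambda>y. f x y)) contour_integrable_on \<Gamma>x"

section \<open>Matrices with polynomial entries\<close>

text \<open>
  Everything lives in \<open>\<complex>[x][y]\<close>: the outer polynomial variable is \<open>y\<close>, the inner one \<open>x\<close>.
\<close>

type_synonym bipoly = "complex poly poly"

abbreviation cst :: "complex \<Rightarrow> bipoly" where
  "cst c \<equiv> [:[:c:]:]"

abbreviation X :: bipoly where
  "X \<equiv> [:[:0, 1:]:]"

abbreviation Y :: bipoly where
  "Y \<equiv> [:0, 1:]"

text \<open>Two-sided inverse over a commutative ring (unspecified if there is none).\<close>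

definition mat_inv :: "'a::comm_ring_1 mat \<Rightarrow> 'a mat" where
  "mat_inv A = (THE B. B \<in> carrier_mat (dim_row A) (dim_row A) \<and>
                       inverts_mat A B \<and> inverts_mat B A)"

definition mats_prod :: "nat \<Rightarrow> 'a::comm_ring_1 mat list \<Rightarrow> 'a mat" where
  "mats_prod n As = foldr (*) As (1\<^sub>m n)"

definition mats_sum :: "nat \<Rightarrow> 'a::comm_ring_1 mat list \<Rightarrow> 'a mat" where
  "mats_sum n As = foldr (+) As (0\<^sub>m n n)"

section \<open>Ladder matrices\<close>

text \<open>
  The \<open>x\<close>- and \<open>y\<close>-objects arise from each other by exchanging \<open>(d\<^sub>2, \<alpha>, x)\<close> and
  \<open>(d\<^sub>1, \<beta>, y)\<close>. With \<open>(d, c, z)\<close> standing for either triple, \<open>ladder d c \<gamma> N z\<close> is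
  \<open>a\<^sub>N(x)\<close> resp. \<open>b\<^sub>N(y)\<close>, and \<open>uladder d c \<gamma> N z\<close> is the underlined
  matrix with upper index \<open>N\<close>. The number \<open>c\<^sub>j(n)\<close> is \<open>c j n\<close>; the index \<open>j\<close> starts at \<open>-1\<close>.
  Matrix indices start at \<open>0\<close>.
\<close>

definition ladder ::
  "nat \<Rightarrow> (int \<Rightarrow> nat \<Rightarrow> complex) \<Rightarrow> (nat \<Rightarrow> complex) \<Rightarrow> nat \<Rightarrow> bipoly \<Rightarrow> bipoly mat" where
  "ladder d c \<gamma> N z = Matrix.mat (d + 1) (d + 1) (\<lambda>(i, k).
     if i = d then cst (1 / \<gamma> N) * ((if k = d then z else 0) - cst (c (int d - int k) N))
     else if k = i + 1 then 1 else 0)"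

definition uladder ::
  "nat \<Rightarrow> (int \<Rightarrow> nat \<Rightarrow> complex) \<Rightarrow> (nat \<Rightarrow> complex) \<Rightarrow> nat \<Rightarrow> bipoly \<Rightarrow> bipoly mat" where
  "uladder d c \<gamma> N z = Matrix.mat (d + 1) (d + 1) (\<lambda>(i, k).
     if k = 0 then cst (1 / \<gamma> (N - 1)) * ((if i = 0 then z else 0) - cst (c (int i) (N + i)))
     else if k = i + 1 then 1 else 0)"

section \<open>Differential matrices\<close>

text \<open>
  \<open>diag_coeffs d c j N\<close> is \<open>diag(c\<^sub>j(N+j-d), \<dots>, c\<^sub>j(N+j))\<close>; all arguments that occur below
  are nonnegative, so that \<open>nat\<close> never truncates. \<open>udiag_coeffs d c j N\<close> is
  \<open>diag(c\<^sub>j(N), \<dots>, c\<^sub>j(N+d))\<close>.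
\<close>

definition diag_coeffs :: "nat \<Rightarrow> (int \<Rightarrow> nat \<Rightarrow> complex) \<Rightarrow> int \<Rightarrow> nat \<Rightarrow> bipoly mat" where
  "diag_coeffs d c j N = mat_diag (d + 1) (\<lambda>i. cst (c j (nat (int N + j - int d + int i))))"

definition udiag_coeffs :: "nat \<Rightarrow> (int \<Rightarrow> nat \<Rightarrow> complex) \<Rightarrow> int \<Rightarrow> nat \<Rightarrow> bipoly mat" where
  "udiag_coeffs d c j N = mat_diag (d + 1) (\<lambda>i. cst (c j (N + i)))"

text \<open>
  In the next two definitions \<open>c\<close> (with band width \<open>d\<close>) enters through the ladder matrices and
  \<open>c'\<close> (with band width \<open>d'\<close>) through the diagonal matrices.
\<close>

definition diff_mat ::
  "nat \<Rightarrow> nat \<Rightarrow> (int \<Rightarrow> nat \<Rightarrow> complex) \<Rightarrow> (int \<Rightarrow> nat \<Rightarrow> complex) \<Rightarrow> (nat \<Rightarrow> complex) \<Rightarrow>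
   nat \<Rightarrow> bipoly \<Rightarrow> bipoly mat" where
  "diff_mat d d' c c' \<gamma> N z =
     diag_coeffs d c' (- 1) N * mat_inv (ladder d c \<gamma> (N - 1) z)
     + diag_coeffs d c' 0 N
     + mats_sum (d + 1)
         (map (\<lambda>j. diag_coeffs d c' (int j) N *
                   mats_prod (d + 1) (map (\<lambda>i. ladder d c \<gamma> (N + i) z) (rev [0..<j])))
              [1..<d' + 1])"

definition udiff_mat ::
  "nat \<Rightarrow> nat \<Rightarrow> (int \<Rightarrow> nat \<Rightarrow> complex) \<Rightarrow> (int \<Rightarrow> nat \<Rightarrow> complex) \<Rightarrow> (nat \<Rightarrow> complex) \<Rightarrow>
   nat \<Rightarrow> bipoly \<Rightarrow> bipoly mat" where
  "udiff_mat d d' c c' \<gamma> N z =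
     mat_inv (uladder d c \<gamma> N z) * udiag_coeffs d c' (- 1) (N - 1)
     + udiag_coeffs d c' 0 (N - 1)
     + mats_sum (d + 1)
         (map (\<lambda>j. mats_prod (d + 1) (map (\<lambda>i. uladder d c \<gamma> (N - i) z) [1..<j + 1]) *
                   udiag_coeffs d c' (int j) (N - 1))
              [1..<d' + 1])"

definition D1 where "D1 d1 d2 \<alpha> \<beta> \<gamma> N x = diff_mat d2 d1 \<alpha> \<beta> \<gamma> N x"
definition D2 where "D2 d1 d2 \<alpha> \<beta> \<gamma> N y = diff_mat d1 d2 \<beta> \<alpha> \<gamma> N y"
definition uD1 where "uD1 d1 d2 \<alpha> \<beta> \<gamma> N x = udiff_mat d2 d1 \<alpha> \<beta> \<gamma> N x"
definition uD2 where "uD2 d1 d2 \<alpha> \<beta> \<gamma> N y = udiff_mat d1 d2 \<beta> \<alpha> \<gamma> N y"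

end

theory Submission
  imports Defs
begin

text \<open>
  Let \<open>Q\<close> and \<open>P\<close> be the semi-infinite band matrices with entries \<open>\<alpha>\<^sub>j(n)\<close> in place
  \<open>(n, n - j)\<close> and \<open>\<beta>\<^sub>j(n + j)\<close> in place \<open>(n, n + j)\<close>, respectively. The rows
  \<open>N - 1, \<dots>, N + d\<^sub>1 - 1\<close> of \<open>Q - x\<close> and the rows \<open>N - d\<^sub>2, \<dots>, N\<close> of \<open>P - y\<close> are supported
  on the same \<open>d\<^sub>1 + d\<^sub>2 + 2\<close> columns and form a square matrix of Sylvester shape. The ladder
  matrices express a vector in the kernel of the \<open>Q\<close>-rows by its entries in the window
  \<open>N - d\<^sub>2, \<dots>, N\<close>; eliminating the other columns leaves \<open>D\<^sub>1(x) - y\<close>. The underlined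
  ladder matrices do the same for the \<open>P\<close>-rows and the window \<open>N - 1, \<dots>, N + d\<^sub>1 - 1\<close>, which
  leaves the transpose of the underlined \<open>D\<^sub>2(y)\<close> minus \<open>x\<close>. So the two characteristic
  polynomials are the same determinant up to the pivots. All pivots are values of \<open>\<gamma>\<close>, except
  for one outermost coefficient of each band matrix; integration by parts evaluates these.
  The other pair of curves arises by exchanging \<open>P\<close> and \<open>Q\<close>.
\<close>

section \<open>Generalised Sylvester determinants\<close>

definition band :: "nat \<Rightarrow> (nat \<Rightarrow> nat \<Rightarrow> 'a::zero) \<Rightarrow> nat \<Rightarrow> nat \<Rightarrow> 'a" where
  "band w r i k = (if i \<le> k \<and> k \<le> i + w then r i (k - i) else 0)"

text \<open>For row-independent \<open>r\<close> and \<open>s\<close> this is a Sylvester matrix of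
  two polynomials of degrees \<open>p + 1\<close> and \<open>q + 1\<close>. Here the coefficients
  may change from row to row, as they do along the diagonals of the recursion matrices.\<close>

definition sylv :: "nat \<Rightarrow> nat \<Rightarrow> (nat \<Rightarrow> nat \<Rightarrow> 'a::zero) \<Rightarrow> (nat \<Rightarrow> nat \<Rightarrow> 'a) \<Rightarrow> 'a mat" where
  "sylv p q r s = Matrix.mat (p + q + 2) (p + q + 2)
     (\<lambda>(i, k). if i \<le> p then band (q + 1) s i k else band (p + 1) r (i - p - 1) k)"

section \<open>Band sums and triangular determinants\<close>

lemma sum_band:
  fixes r :: "nat \<Rightarrow> nat \<Rightarrow> 'a::semiring_0"
  assumes "i + w < n"
  shows "(\<Sum>k<n. band w r i k * f k) = (\<Sum>k\<le>w. r i k * f (i + k))"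
proof -
  have "(\<Sum>k<n. band w r i k * f k) = (\<Sum>k\<in>{i..i + w}. r i (k - i) * f k)"
    by (rule sum.mono_neutral_cong_right) (use assms in \<open>auto simp: band_def\<close>)
  also have "\<dots> = (\<Sum>k\<le>w. r i k * f (i + k))"
    by (rule sum.reindex_bij_witness[of _ "\<lambda>k. i + k" "\<lambda>k. k - i"]) auto
  finally show ?thesis .
qed

lemma det_block_upper_zero:
  fixes f :: "nat \<Rightarrow> nat \<Rightarrow> 'a::idom"
  assumes "\<And>i j. i < a \<Longrightarrow> j < b \<Longrightarrow> f i (j + a) = 0"
  shows "Determinant.det (Matrix.mat (a + b) (a + b) (\<lambda>(i, j). f i j)) =
    Determinant.det (Matrix.mat a a (\<lambda>(i, j). f i j)) *
    Determinant.det (Matrix.mat b b (\<lambda>(i, j). f (i + a) (j + a)))"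
proof -
  have "f i j = 0" if "i < a" "\<not> j < a" "j < a + b" for i j
    using assms[of i "j - a"] that by simp
  then have "Matrix.mat (a + b) (a + b) (\<lambda>(i, j). f i j) =
    four_block_mat (Matrix.mat a a (\<lambda>(i, j). f i j)) (0\<^sub>m a b)
      (Matrix.mat b a (\<lambda>(i, j). f (i + a) j)) (Matrix.mat b b (\<lambda>(i, j). f (i + a) (j + a)))"
    by (intro eq_matI) auto
  then show ?thesis
    by (simp add: det_four_block_mat_upper_right_zero[where n = a and m = b])
qed

lemma det_block_lower_zero:
  fixes f :: "nat \<Rightarrow> nat \<Rightarrow> 'a::idom"
  assumes "\<And>i j. i < b \<Longrightarrow> j < a \<Longrightarrow> f (i + a) j = 0"
  shows "Determinant.det (Matrix.mat (a + b) (a + b) (\<lambda>(i, j). f i j)) =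
    Determinant.det (Matrix.mat a a (\<lambda>(i, j). f i j)) *
    Determinant.det (Matrix.mat b b (\<lambda>(i, j). f (i + a) (j + a)))"
proof -
  have "f i j = 0" if "\<not> i < a" "i < a + b" "j < a" for i j
    using assms[of "i - a" j] that by simp
  then have "Matrix.mat (a + b) (a + b) (\<lambda>(i, j). f i j) =
    four_block_mat (Matrix.mat a a (\<lambda>(i, j). f i j)) (Matrix.mat a b (\<lambda>(i, j). f i (j + a)))
      (0\<^sub>m b a) (Matrix.mat b b (\<lambda>(i, j). f (i + a) (j + a)))"
    by (intro eq_matI) auto
  then show ?thesis
    by (simp add: det_four_block_mat_lower_left_zero[where n = a and m = b])
qed

lemma det_mat_lower_triangular:
  fixes f :: "nat \<Rightarrow> nat \<Rightarrow> 'a::idom"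
  assumes "\<And>i j. i < j \<Longrightarrow> j < n \<Longrightarrow> f i j = 0"
  shows "Determinant.det (Matrix.mat n n (\<lambda>(i, j). f i j)) = (\<Prod>i<n. f i i)"
proof -
  have "Determinant.det (Matrix.mat n n (\<lambda>(i, j). f i j)) =
      prod_list (diag_mat (Matrix.mat n n (\<lambda>(i, j). f i j)))"
    by (rule det_lower_triangular[of n]) (use assms in auto)
  also have "diag_mat (Matrix.mat n n (\<lambda>(i, j). f i j)) = map (\<lambda>i. f i i) [0..<n]"
    by (auto simp: diag_mat_def)
  finally show ?thesis
    by (simp add: prod.list_conv_set_nth atLeast0LessThan)
qed

text \<open>
  The columns \<open>e w\<close> span the common kernel of the \<open>r\<close>-rows and restrict to the unit vectors on
  the window \<open>1, \<dots>, p + 1\<close>. Replacing the window columns by them makes the matrix block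
  triangular.
\<close>

lemma det_sylv_elim:
  fixes r s e :: "nat \<Rightarrow> nat \<Rightarrow> 'a::idom"
  assumes window: "\<And>k w. k \<le> p \<Longrightarrow> w \<le> p \<Longrightarrow> e w (k + 1) = (if k = w then 1 else 0)"
    and kernel: "\<And>i w. i \<le> q \<Longrightarrow> w \<le> p \<Longrightarrow> (\<Sum>k\<le>p + 1. r i k * e w (i + k)) = 0"
  shows "Determinant.det (sylv p q r s) = (- 1) ^ (p + 1) * r 0 0 * (\<Prod>i = 1..q. r i (p + 1)) *
    Determinant.det (Matrix.mat (p + 1) (p + 1) (\<lambda>(i, w). \<Sum>k\<le>q + 1. s i k * e w (i + k)))"
proof -
  define n where "n = p + q + 2"
  \<comment> \<open>\<open>m\<close> has the first \<open>r\<close>-row on top, where it supplies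
    the pivot of column 0. Passing the \<open>p + 1\<close> rows of \<open>s\<close> costs the sign
    in the conclusion.\<close>
  define m where "m i k = (if i = 0 then band (p + 1) r 0 k
    else if i \<le> p + 1 then band (q + 1) s (i - 1) k else band (p + 1) r (i - p - 1) k)" for i k
  define g where "g k l = (if 1 \<le> l \<and> l \<le> p + 1 then e (l - 1) k else if k = l then 1 else 0)"
    for k l
  define mg where "mg i l = (\<Sum>k<n. m i k * g k l)" for i l
  let ?mat = "\<lambda>f. Matrix.mat n n (\<lambda>(i, k). f i k)"
  let ?det = Determinant.det
  have sylv: "?det (sylv p q r s) = (- 1) ^ (p + 1) * ?det (?mat m)"
  proof -
    have eq: "Matrix.mat n n (\<lambda>(i, j). sylv p q r s $$ (if i < 1 then i + (p + 1)
        else if i < (p + 1) + 1 then i - 1 else i, j)) = ?mat m"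
      by (intro eq_matI) (auto simp: sylv_def m_def n_def)
    show ?thesis
      using det_swap_initial_rows[of "sylv p q r s" n "p + 1" 1]
      unfolding eq by (simp add: sylv_def n_def)
  qed
  \<comment> \<open>Column 0 of \<open>g\<close> is a unit vector, so the values
    \<open>e w 0\<close> do not enter the determinant. What remains is lower triangular with unit
    diagonal by \<open>window\<close>.\<close>
  have det_g: "?det (?mat g) = 1"
  proof -
    have "?det (?mat g) = ?det (Matrix.mat 1 1 (\<lambda>(i, k). g i k)) *
        ?det (Matrix.mat (p + q + 1) (p + q + 1) (\<lambda>(i, k). g (i + 1) (k + 1)))"
      using det_block_lower_zero[of "p + q + 1" 1 g] by (simp add: g_def n_def)
    also have "?det (Matrix.mat 1 1 (\<lambda>(i, k). g i k)) = 1"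
      by (subst det_mat_lower_triangular) (auto simp: g_def)
    also have "?det (Matrix.mat (p + q + 1) (p + q + 1) (\<lambda>(i, k). g (i + 1) (k + 1))) =
        (\<Prod>i<p + q + 1. g (i + 1) (i + 1))"
      by (rule det_mat_lower_triangular) (use window in \<open>auto simp: g_def\<close>)
    also have "\<dots> = 1"
      by (rule prod.neutral) (use window in \<open>auto simp: g_def\<close>)
    finally show ?thesis by simp
  qed
  have mult: "?mat m * ?mat g = ?mat mg"
    by (intro eq_matI) (auto simp: mg_def scalar_prod_def atLeast0LessThan)
  have mg_out: "mg i l = m i l" if "l < n" "l = 0 \<or> p + 1 < l" for i l
  proof -
    have "mg i l = (\<Sum>k<n. if k = l then m i k else 0)"
      unfolding mg_def by (rule sum.cong) (use that in \<open>auto simp: g_def\<close>)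
    then show ?thesis using that by simp
  qed
  have mg_in: "mg i (w + 1) = (\<Sum>k<n. m i k * e w k)" if "w \<le> p" for i w
    unfolding mg_def by (rule sum.cong) (use that in \<open>auto simp: g_def\<close>)
  \<comment> \<open>The case distinction lists the rows of \<open>m\<close> that hold
    \<open>r\<close>-rows: row 0 and the rows after the \<open>s\<close>-block.\<close>
  have mg_r: "mg (if i = 0 then 0 else i + p + 1) (w + 1) = 0" if "w \<le> p" "i \<le> q" for i w
  proof -
    have "mg (if i = 0 then 0 else i + p + 1) (w + 1) = (\<Sum>k<n. band (p + 1) r i k * e w k)"
      unfolding mg_in[OF that(1)] by (rule sum.cong) (auto simp: m_def)
    also have "\<dots> = 0"
      using that kernel[of i w] by (subst sum_band) (auto simp: n_def)
    finally show ?thesis .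
  qed
  have mg_s: "mg (i + 1) (w + 1) = (\<Sum>k\<le>q + 1. s i k * e w (i + k))" if "w \<le> p" "i \<le> p" for i w
  proof -
    have "mg (i + 1) (w + 1) = (\<Sum>k<n. band (q + 1) s i k * e w k)"
      unfolding mg_in[OF that(1)] by (rule sum.cong) (use that in \<open>auto simp: m_def\<close>)
    also have "\<dots> = (\<Sum>k\<le>q + 1. s i k * e w (i + k))"
      using that by (subst sum_band) (auto simp: n_def)
    finally show ?thesis .
  qed
  have row0: "mg 0 (j + 1) = 0" if "j < p + q + 1" for j
  proof (cases "j \<le> p")
    case True
    then show ?thesis using mg_r[of j 0] by simp
  next
    case False
    then show ?thesis using that by (subst mg_out) (auto simp: m_def band_def n_def)
  qed
  have "?det (?mat m) = ?det (?mat m * ?mat g)"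
    by (subst det_mult[of _ n]) (auto simp: det_g)
  also have "\<dots> = ?det (Matrix.mat 1 1 (\<lambda>(i, k). mg i k)) *
      ?det (Matrix.mat (p + q + 1) (p + q + 1) (\<lambda>(i, k). mg (i + 1) (k + 1)))"
    unfolding mult using det_block_upper_zero[of 1 "p + q + 1" mg] row0 by (simp add: n_def)
  also have "?det (Matrix.mat 1 1 (\<lambda>(i, k). mg i k)) = r 0 0"
    by (subst det_mat_lower_triangular) (auto simp: mg_out n_def m_def band_def)
  also have "?det (Matrix.mat (p + q + 1) (p + q + 1) (\<lambda>(i, k). mg (i + 1) (k + 1))) =
      ?det (Matrix.mat (p + 1) (p + 1) (\<lambda>(i, k). mg (i + 1) (k + 1))) *
      ?det (Matrix.mat q q (\<lambda>(i, k). mg (i + (p + 1) + 1) (k + (p + 1) + 1)))"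
  proof -
    have "mg (i + (p + 1) + 1) (j + 1) = 0" if "i < q" "j < p + 1" for i j
      using mg_r[of j "i + 1"] that by (simp add: add_ac)
    then show ?thesis
      using det_block_lower_zero[of q "p + 1" "\<lambda>i k. mg (i + 1) (k + 1)"]
      by (simp add: add_ac)
  qed
  \<comment> \<open>To the right of the window the last entry of each remaining \<open>r\<close>-row
    lies on the diagonal, and its band ends there.\<close>
  also have "?det (Matrix.mat q q (\<lambda>(i, k). mg (i + (p + 1) + 1) (k + (p + 1) + 1))) =
      (\<Prod>i<q. mg (i + (p + 1) + 1) (i + (p + 1) + 1))"
    by (rule det_mat_lower_triangular) (auto simp: mg_out n_def m_def band_def)
  also have "\<dots> = (\<Prod>i<q. r (i + 1) (p + 1))"
    by (rule prod.cong) (auto simp: mg_out n_def m_def band_def)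
  also have "\<dots> = (\<Prod>i = 1..q. r i (p + 1))"
    by (rule prod.reindex_bij_witness[of _ "\<lambda>i. i - 1" "\<lambda>i. i + 1"]) auto
  also have "Matrix.mat (p + 1) (p + 1) (\<lambda>(i, k). mg (i + 1) (k + 1)) =
      Matrix.mat (p + 1) (p + 1) (\<lambda>(i, w). \<Sum>k\<le>q + 1. s i k * e w (i + k))"
    by (intro eq_matI) (use mg_s in auto)
  finally show ?thesis
    unfolding sylv by (simp add: mult_ac)
qed

section \<open>Half-turn of a matrix\<close>

lemma det_reverse:
  fixes A :: "'a::comm_ring_1 mat"
  assumes A: "A \<in> carrier_mat n n"
  shows "Determinant.det (Matrix.mat n n (\<lambda>(i, j). A $$ (n - 1 - i, n - 1 - j))) = Determinant.det A"
proof -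
  \<comment> \<open>The half-turn is conjugation by the antidiagonal permutation matrix. Since this
    is an involution, the sign of its determinant never has to be computed.\<close>
  define J :: "'a mat" where "J = Matrix.mat n n (\<lambda>(i, j). if i + j + 1 = n then 1 else 0)"
  have J: "J \<in> carrier_mat n n" by (simp add: J_def)
  have left: "J * B = Matrix.mat n n (\<lambda>(i, j). B $$ (n - 1 - i, j))"
    if B: "B \<in> carrier_mat n n" for B
  proof (rule eq_matI)
    fix i j
    assume "i < dim_row (Matrix.mat n n (\<lambda>(i, j). B $$ (n - 1 - i, j)))"
      and "j < dim_col (Matrix.mat n n (\<lambda>(i, j). B $$ (n - 1 - i, j)))"
    then have ij: "i < n" "j < n" by simp_all
    have "(J * B) $$ (i, j) = (\<Sum>k<n. (if i + k + 1 = n then 1 else 0) * B $$ (k, j))"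
      using ij B by (simp add: J_def scalar_prod_def atLeast0LessThan)
    also have "\<dots> = (\<Sum>k<n. if k = n - 1 - i then B $$ (k, j) else 0)"
      by (rule sum.cong) (use ij in auto)
    finally show "(J * B) $$ (i, j) = Matrix.mat n n (\<lambda>(i, j). B $$ (n - 1 - i, j)) $$ (i, j)"
      using ij by simp
  qed (use J B in auto)
  have right: "B * J = Matrix.mat n n (\<lambda>(i, j). B $$ (i, n - 1 - j))"
    if B: "B \<in> carrier_mat n n" for B
  proof (rule eq_matI)
    fix i j
    assume "i < dim_row (Matrix.mat n n (\<lambda>(i, j). B $$ (i, n - 1 - j)))"
      and "j < dim_col (Matrix.mat n n (\<lambda>(i, j). B $$ (i, n - 1 - j)))"
    then have ij: "i < n" "j < n" by simp_all
    have "(B * J) $$ (i, j) = (\<Sum>k<n. B $$ (i, k) * (if k + j + 1 = n then 1 else 0))"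
      using ij B by (simp add: J_def scalar_prod_def atLeast0LessThan)
    also have "\<dots> = (\<Sum>k<n. if k = n - 1 - j then B $$ (i, k) else 0)"
      by (rule sum.cong) (use ij in auto)
    finally show "(B * J) $$ (i, j) = Matrix.mat n n (\<lambda>(i, j). B $$ (i, n - 1 - j)) $$ (i, j)"
      using ij by simp
  qed (use J B in auto)
  have JJ: "J * J = 1\<^sub>m n"
    unfolding left[OF J] by (intro eq_matI) (auto simp: J_def)
  have "Matrix.mat n n (\<lambda>(i, j). A $$ (n - 1 - i, n - 1 - j)) = J * (A * J)"
    unfolding right[OF A] by (subst left) (auto intro!: eq_matI)
  also have "Determinant.det \<dots> = Determinant.det A * Determinant.det (J * J)"
    using A J by (simp add: det_mult[of _ n] mult_ac)
  finally show ?thesis by (simp add: JJ)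
qed

lemma band_reverse:
  assumes "i \<le> p" "k \<le> p + w"
  shows "band w (\<lambda>i k. s (p - i) (w - k)) i k = band w s (p - i) (p + w - k)"
proof (cases "i \<le> k \<and> k \<le> i + w")
  case True
  then have "w - (k - i) = p + w - k - (p - i)" "p - i \<le> p + w - k" "p + w - k \<le> p - i + w"
    using assms by linarith+
  then show ?thesis using True by (simp add: band_def)
next
  case False
  then have "\<not> (p - i \<le> p + w - k \<and> p + w - k \<le> p - i + w)"
    using assms by linarith
  then show ?thesis unfolding band_def using False by (simp only: if_False)
qed

text \<open>The half-turn reverses the order of the rows and sends offset \<open>k\<close> in an
  \<open>r\<close>-row to \<open>p + 1 - k\<close>, in an \<open>s\<close>-row to
  \<open>q + 1 - k\<close>. The \<open>r\<close>-rows land on top and so become the second band of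
  the new matrix.\<close>

lemma det_sylv_reverse:
  fixes r s :: "nat \<Rightarrow> nat \<Rightarrow> 'a::comm_ring_1"
  shows "Determinant.det (sylv q p (\<lambda>i k. s (p - i) (q + 1 - k)) (\<lambda>i k. r (q - i) (p + 1 - k))) =
    Determinant.det (sylv p q r s)"
proof -
  let ?n = "p + q + 2"
  let ?s = "\<lambda>i k. s (p - i) (q + 1 - k)" and ?r = "\<lambda>i k. r (q - i) (p + 1 - k)"
  have S: "sylv p q r s \<in> carrier_mat ?n ?n" by (simp add: sylv_def)
  have "sylv q p ?s ?r = Matrix.mat ?n ?n (\<lambda>(i, j). sylv p q r s $$ (?n - 1 - i, ?n - 1 - j))"
  proof (rule eq_matI)
    fix i j
    assume "i < dim_row (Matrix.mat ?n ?n (\<lambda>(i, j). sylv p q r s $$ (?n - 1 - i, ?n - 1 - j)))"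
      and "j < dim_col (Matrix.mat ?n ?n (\<lambda>(i, j). sylv p q r s $$ (?n - 1 - i, ?n - 1 - j)))"
    then have ij: "i < ?n" "j < ?n" by simp_all
    have lhs: "sylv q p ?s ?r $$ (i, j) =
        (if i \<le> q then band (p + 1) ?r i j else band (q + 1) ?s (i - q - 1) j)"
      using ij by (simp add: sylv_def)
    have rhs: "sylv p q r s $$ (?n - 1 - i, ?n - 1 - j) =
        (if q < i then band (q + 1) s (p - (i - q - 1)) (p + (q + 1) - j)
         else band (p + 1) r (q - i) (q + (p + 1) - j))"
    proof (cases "q < i")
      case True
      then have "?n - 1 - i = p - (i - q - 1)" "?n - 1 - i \<le> p" "?n - 1 - j = p + (q + 1) - j"
        using ij by linarith+
      then show ?thesis using True ij by (simp add: sylv_def)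
    next
      case False
      then have "?n - 1 - i - p - 1 = q - i" "\<not> ?n - 1 - i \<le> p" "?n - 1 - j = q + (p + 1) - j"
        using ij by linarith+
      then show ?thesis using False ij by (simp add: sylv_def)
    qed
    have "sylv q p ?s ?r $$ (i, j) = sylv p q r s $$ (?n - 1 - i, ?n - 1 - j)"
    proof (cases "q < i")
      case True
      then show ?thesis
        unfolding lhs rhs using band_reverse[of "i - q - 1" p j "q + 1" s] ij by simp
    next
      case False
      then show ?thesis
        unfolding lhs rhs using band_reverse[of i q j "p + 1" r] ij by simp
    qed
    then show "sylv q p ?s ?r $$ (i, j) =
        Matrix.mat ?n ?n (\<lambda>(i, j). sylv p q r s $$ (?n - 1 - i, ?n - 1 - j)) $$ (i, j)"
      using ij by simp
  qed (simp_all add: sylv_def)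
  then show ?thesis using det_reverse[OF S] by simp
qed

section \<open>Elimination by ladder matrices\<close>

text \<open>
  Reflection in the antidiagonal turns underlined ladder matrices into companion matrices of the
  same shape as the ladder matrices.
\<close>

definition flip_mat :: "nat \<Rightarrow> 'a mat \<Rightarrow> 'a mat" where
  "flip_mat n A = Matrix.mat n n (\<lambda>(i, j). A $$ (n - 1 - j, n - 1 - i))"

lemma flip_mat_carrier: "flip_mat n A \<in> carrier_mat n n"
  by (simp add: flip_mat_def)

lemma flip_mat_index [simp]:
  "i < n \<Longrightarrow> j < n \<Longrightarrow> flip_mat n A $$ (i, j) = A $$ (n - 1 - j, n - 1 - i)"
  by (simp add: flip_mat_def)

lemma flip_mat_flip_mat:
  assumes "A \<in> carrier_mat n n"
  shows "flip_mat n (flip_mat n A) = A"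
  by (rule eq_matI) (use assms in \<open>auto simp: flip_mat_def\<close>)

lemma flip_mat_one: "flip_mat n (1\<^sub>m n) = 1\<^sub>m n"
  by (rule eq_matI) (auto simp: flip_mat_def)

text \<open>Like transposition, the flip is an antiautomorphism. It turns products that grow on the
  right, as in \<open>udiff_mat\<close>, into products that grow on the left, as in
  \<open>diff_mat\<close>.\<close>

lemma flip_mat_mult:
  fixes A B :: "'a::comm_semiring_0 mat"
  assumes A: "A \<in> carrier_mat n n" and B: "B \<in> carrier_mat n n"
  shows "flip_mat n (A * B) = flip_mat n B * flip_mat n A"
proof (rule eq_matI)
  fix i j
  assume "i < dim_row (flip_mat n B * flip_mat n A)" "j < dim_col (flip_mat n B * flip_mat n A)"
  then have ij: "i < n" "j < n" by (simp_all add: flip_mat_def)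
  have "flip_mat n (A * B) $$ (i, j) = (\<Sum>k<n. A $$ (n - 1 - j, k) * B $$ (k, n - 1 - i))"
    using ij A B by (simp add: scalar_prod_def atLeast0LessThan)
  also have "\<dots> = (\<Sum>k<n. A $$ (n - 1 - j, n - 1 - k) * B $$ (n - 1 - k, n - 1 - i))"
    by (rule sum.reindex_bij_witness[of _ "\<lambda>k. n - 1 - k" "\<lambda>k. n - 1 - k"]) auto
  also have "\<dots> = (flip_mat n B * flip_mat n A) $$ (i, j)"
    using ij by (simp add: flip_mat_def scalar_prod_def atLeast0LessThan mult.commute)
  finally show "flip_mat n (A * B) $$ (i, j) = (flip_mat n B * flip_mat n A) $$ (i, j)" .
qed (simp_all add: flip_mat_def)

text \<open>The flip is transposition followed by the half-turn, and both preserve the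
  determinant.\<close>

lemma det_flip_mat:
  fixes A :: "'a::comm_ring_1 mat"
  assumes A: "A \<in> carrier_mat n n"
  shows "Determinant.det (flip_mat n A) = Determinant.det A"
proof -
  have "flip_mat n A =
      Matrix.mat n n (\<lambda>(i, j). transpose_mat A $$ (n - 1 - i, n - 1 - j))"
    by (rule eq_matI) (use A in \<open>auto simp: flip_mat_def\<close>)
  then show ?thesis
    using det_reverse[of "transpose_mat A" n] A by (simp add: det_transpose)
qed

section \<open>Companion matrices and their inverses\<close>

lemma mat_inv_eqI:
  fixes A B :: "'a::comm_ring_1 mat"
  assumes A: "A \<in> carrier_mat n n" and B: "B \<in> carrier_mat n n"
    and AB: "A * B = 1\<^sub>m n" and BA: "B * A = 1\<^sub>m n"
  shows "mat_inv A = B"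
  unfolding mat_inv_def
proof (rule the_equality)
  show "B \<in> carrier_mat (dim_row A) (dim_row A) \<and> inverts_mat A B \<and> inverts_mat B A"
    using assms by (simp add: inverts_mat_def)
next
  fix C assume C: "C \<in> carrier_mat (dim_row A) (dim_row A) \<and> inverts_mat A C \<and> inverts_mat C A"
  then have Cn: "C \<in> carrier_mat n n" and CA: "C * A = 1\<^sub>m n"
    using A by (auto simp: inverts_mat_def)
  have "C = C * (A * B)" using Cn AB by simp
  also have "\<dots> = (C * A) * B" using assoc_mult_mat[OF Cn A B] by simp
  also have "\<dots> = B" using B CA by simp
  finally show "C = B" .
qed

text \<open>Applied to \<open>p + 1\<close> consecutive terms of a sequence, this matrix moves the
  window one place forward, the new term being given by a linear recursion with coefficients
  \<rho>.\<close>

definition companion :: "nat \<Rightarrow> (nat \<Rightarrow> 'a::{zero,one}) \<Rightarrow> 'a mat" where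
  "companion p \<rho> = Matrix.mat (p + 1) (p + 1)
     (\<lambda>(i, k). if i = p then \<rho> k else if k = i + 1 then 1 else 0)"

lemma companion_carrier: "companion p \<rho> \<in> carrier_mat (p + 1) (p + 1)"
  by (simp add: companion_def)

lemma companion_mult_index:
  fixes \<rho> :: "nat \<Rightarrow> 'a::comm_semiring_1"
  assumes A: "A \<in> carrier_mat (p + 1) (p + 1)" and "i \<le> p" "w \<le> p"
  shows "(companion p \<rho> * A) $$ (i, w) =
    (if i = p then \<Sum>k\<le>p. \<rho> k * A $$ (k, w) else A $$ (i + 1, w))"
proof -
  have "(companion p \<rho> * A) $$ (i, w) = (\<Sum>k<p + 1. companion p \<rho> $$ (i, k) * A $$ (k, w))"
    using assms by (simp add: companion_def scalar_prod_def atLeast0LessThan)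
  also have "\<dots> = (\<Sum>k<p + 1. if i = p then \<rho> k * A $$ (k, w)
      else if k = i + 1 then A $$ (k, w) else 0)"
    by (rule sum.cong) (use assms in \<open>auto simp: companion_def\<close>)
  also have "\<dots> = (if i = p then \<Sum>k\<le>p. \<rho> k * A $$ (k, w) else A $$ (i + 1, w))"
    using assms by (auto simp: lessThan_Suc_atMost)
  finally show ?thesis .
qed

text \<open>The inverse moves the window one place back. It solves the recursion for its oldest
  term, which is possible because the coefficient of that term is a unit; this gives the first row
  of the witness.\<close>

lemma companion_inverse_exists:
  fixes \<rho> :: "nat \<Rightarrow> 'a::comm_ring_1"
  assumes unit: "\<rho> 0 * \<kappa> = 1"
  shows "\<exists>B \<in> carrier_mat (p + 1) (p + 1).
    companion p \<rho> * B = 1\<^sub>m (p + 1) \<and> B * companion p \<rho> = 1\<^sub>m (p + 1)"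
proof -
  define B where "B = Matrix.mat (p + 1) (p + 1) (\<lambda>(i, w).
    if i = 0 then \<kappa> * (if w = p then 1 else - \<rho> (w + 1)) else if w + 1 = i then 1 else 0)"
  have B: "B \<in> carrier_mat (p + 1) (p + 1)" by (simp add: B_def)
  have "companion p \<rho> * B = 1\<^sub>m (p + 1)"
  proof (rule eq_matI)
    fix i w assume "i < dim_row (1\<^sub>m (p + 1) :: 'a mat)" "w < dim_col (1\<^sub>m (p + 1) :: 'a mat)"
    then have iw: "i \<le> p" "w \<le> p" by simp_all
    show "(companion p \<rho> * B) $$ (i, w) = 1\<^sub>m (p + 1) $$ (i, w)"
    proof (cases "i = p")
      case False
      then show ?thesis
        using iw unfolding companion_mult_index[OF B iw] by (auto simp: B_def)
    next
      case True
      have "(\<Sum>k\<le>p. \<rho> k * B $$ (k, w)) = (\<Sum>k\<in>{0} \<union> {1..p}. \<rho> k * B $$ (k, w))"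
        by (rule sum.cong) auto
      also have "\<dots> = \<rho> 0 * B $$ (0, w) + (\<Sum>k = 1..p. \<rho> k * B $$ (k, w))"
        by (subst sum.union_disjoint) auto
      also have "(\<Sum>k = 1..p. \<rho> k * B $$ (k, w)) = (\<Sum>k = 1..p. if k = w + 1 then \<rho> k else 0)"
        by (rule sum.cong) (use iw in \<open>auto simp: B_def\<close>)
      also have "\<rho> 0 * B $$ (0, w) = (if w = p then 1 else - \<rho> (w + 1))"
        using iw unit by (simp add: B_def mult.assoc[symmetric])
      finally show ?thesis
        using iw True unfolding companion_mult_index[OF B iw] by auto
    qed
  qed (use B in \<open>auto simp: companion_def\<close>)
  moreover have "B * companion p \<rho> = 1\<^sub>m (p + 1)"
  proof (rule eq_matI)
    fix i w assume "i < dim_row (1\<^sub>m (p + 1) :: 'a mat)" "w < dim_col (1\<^sub>m (p + 1) :: 'a mat)"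
    then have iw: "i \<le> p" "w \<le> p" by simp_all
    have *: "(B * companion p \<rho>) $$ (i, w) = (\<Sum>k\<le>p. B $$ (i, k) * companion p \<rho> $$ (k, w))"
      using iw B by (simp add: companion_def scalar_prod_def atLeast0LessThan lessThan_Suc_atMost)
    show "(B * companion p \<rho>) $$ (i, w) = 1\<^sub>m (p + 1) $$ (i, w)"
    proof (cases "i = 0")
      case False
      have "(\<Sum>k\<le>p. B $$ (i, k) * companion p \<rho> $$ (k, w)) =
          (\<Sum>k\<le>p. if k = i - 1 then companion p \<rho> $$ (k, w) else 0)"
        by (rule sum.cong) (use iw False in \<open>auto simp: B_def\<close>)
      then show ?thesis
        using iw False unfolding * by (auto simp: companion_def)
    next
      case True
      have "(\<Sum>k\<le>p. B $$ (0, k) * companion p \<rho> $$ (k, w)) =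
          (\<Sum>k\<in>insert p {..<p}. B $$ (0, k) * companion p \<rho> $$ (k, w))"
        by (rule sum.cong) auto
      also have "\<dots> = \<kappa> * \<rho> w + (\<Sum>k<p. B $$ (0, k) * companion p \<rho> $$ (k, w))"
        using iw by (subst sum.insert) (auto simp: B_def companion_def)
      \<comment> \<open>Column 0 meets no shifted unit entry. At \<open>w = 0\<close> the summand is
        therefore set to zero, and the truncated index \<open>w - 1\<close> is harmless.\<close>
      also have "(\<Sum>k<p. B $$ (0, k) * companion p \<rho> $$ (k, w)) =
          (\<Sum>k<p. if k = w - 1 then (if w = 0 then 0 else - (\<kappa> * \<rho> w)) else 0)"
        by (rule sum.cong) (use iw in \<open>auto simp: B_def companion_def\<close>)
      also have "\<kappa> * \<rho> w + \<dots> = (if w = 0 then 1 else 0)"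
        using iw unit by (auto simp: mult.commute)
      finally show ?thesis
        using iw unfolding True *[unfolded True] by auto
    qed
  qed (use B in \<open>auto simp: companion_def\<close>)
  ultimately show ?thesis using B by blast
qed

text \<open>The matrix \<open>A j\<close> holds the entries of the kernel vectors in the columns
  from \<open>j\<close> to \<open>j + p\<close>. Solving row \<open>j\<close> of \<open>r\<close>
  for its last entry gives the recursion coefficients \<open>\<rho> j\<close>, hence
  \<open>A_Suc\<close>; \<open>A_1\<close> normalises the vectors on the elimination window.\<close>

lemma det_sylv_companion:
  fixes r s \<rho> :: "nat \<Rightarrow> nat \<Rightarrow> 'a::idom" and A :: "nat \<Rightarrow> 'a mat"
  assumes A: "\<And>j. A j \<in> carrier_mat (p + 1) (p + 1)"
    and A_Suc: "\<And>j. j \<le> q \<Longrightarrow> A (Suc j) = companion p (\<rho> j) * A j"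
    and A_1: "A 1 = 1\<^sub>m (p + 1)"
    and r: "\<And>j k. j \<le> q \<Longrightarrow> k \<le> p \<Longrightarrow> r j k = - (r j (p + 1) * \<rho> j k)"
  shows "Determinant.det (sylv p q r s) = (- 1) ^ (p + 1) * r 0 0 * (\<Prod>i = 1..q. r i (p + 1)) *
    Determinant.det (Matrix.mat (p + 1) (p + 1) (\<lambda>(i, w). \<Sum>k\<le>q + 1. s i k * A k $$ (i, w)))"
proof -
  \<comment> \<open>The first \<open>p + 1\<close> entries are read off \<open>A 0\<close>. Every
    later entry is the newest term produced by some step of the recursion, hence in the last row of
    \<open>A (k - p)\<close>.\<close>
  define e where "e w k = (if k \<le> p then A 0 $$ (k, w) else A (k - p) $$ (p, w))" for w k
  have A_Suc': "A (Suc j) $$ (i, w) =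
      (if i = p then \<Sum>k\<le>p. \<rho> j k * A j $$ (k, w) else A j $$ (i + 1, w))"
    if "j \<le> q" "i \<le> p" "w \<le> p" for i j w
    using A_Suc[OF that(1)] companion_mult_index[OF A that(2,3)] by simp
  have e: "e w (i + j) = A j $$ (i, w)" if "j \<le> q + 1" "i \<le> p" "w \<le> p" for i j w
    using that
  proof (induction j arbitrary: i)
    case 0
    then show ?case by (simp add: e_def)
  next
    case (Suc j)
    show ?case
    proof (cases "i = p")
      case True
      then show ?thesis by (simp add: e_def)
    next
      case False
      then show ?thesis
        using Suc.IH[of "i + 1"] Suc.prems A_Suc'[of j i w] by simp
    qed
  qed
  have "Determinant.det (sylv p q r s) = (- 1) ^ (p + 1) * r 0 0 * (\<Prod>i = 1..q. r i (p + 1)) *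
    Determinant.det (Matrix.mat (p + 1) (p + 1) (\<lambda>(i, w). \<Sum>k\<le>q + 1. s i k * e w (i + k)))"
  proof (rule det_sylv_elim)
    fix k w assume "k \<le> p" "w \<le> p"
    then show "e w (k + 1) = (if k = w then 1 else 0)"
      using e[of 1 k w] A_1 by simp
  next
    fix i w assume iw: "i \<le> q" "w \<le> p"
    have "(\<Sum>k\<le>p. r i k * e w (i + k)) = - (r i (p + 1) * (\<Sum>k\<le>p. \<rho> i k * A i $$ (k, w)))"
      unfolding sum_distrib_left sum_negf[symmetric]
    proof (rule sum.cong)
      fix k assume "k \<in> {..p}"
      then show "r i k * e w (i + k) = - (r i (p + 1) * (\<rho> i k * A i $$ (k, w)))"
        using iw e[of i k w] r[of i k] by (simp add: add.commute mult.assoc)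
    qed simp
    moreover have "e w (i + (p + 1)) = (\<Sum>k\<le>p. \<rho> i k * A i $$ (k, w))"
      using e[of "Suc i" p w] A_Suc'[of i p w] iw by (simp add: add.commute)
    ultimately show "(\<Sum>k\<le>p + 1. r i k * e w (i + k)) = 0" by simp
  qed
  also have "Matrix.mat (p + 1) (p + 1) (\<lambda>(i, w). \<Sum>k\<le>q + 1. s i k * e w (i + k)) =
      Matrix.mat (p + 1) (p + 1) (\<lambda>(i, w). \<Sum>k\<le>q + 1. s i k * A k $$ (i, w))"
    by (rule eq_matI) (auto simp: e simp del: sum.atMost_Suc intro!: sum.cong)
  finally show ?thesis .
qed

section \<open>Entries of sums and products of lists of matrices\<close>

lemma mats_sum_carrier:
  assumes "\<And>A. A \<in> set As \<Longrightarrow> A \<in> carrier_mat n n"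
  shows "mats_sum n As \<in> carrier_mat n n"
  using assms by (induction As) (auto simp: mats_sum_def)

lemma mats_sum_index:
  assumes "\<And>A. A \<in> set As \<Longrightarrow> A \<in> carrier_mat n n" and "i < n" "j < n"
  shows "mats_sum n As $$ (i, j) = (\<Sum>A\<leftarrow>As. A $$ (i, j))"
  using assms(1)
proof (induction As)
  case Nil
  then show ?case using assms(2,3) by (simp add: mats_sum_def)
next
  case (Cons A As)
  then have "mats_sum n As \<in> carrier_mat n n" by (intro mats_sum_carrier) auto
  then have "(A + mats_sum n As) $$ (i, j) = A $$ (i, j) + mats_sum n As $$ (i, j)"
    using assms(2,3) by auto
  then show ?case using Cons by (simp add: mats_sum_def)
qed

lemma mats_sum_map_index:
  assumes "\<And>k. T k \<in> carrier_mat n n" and "i < n" "j < n"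
  shows "mats_sum n (map T [a..<b]) $$ (i, j) = (\<Sum>k = a..<b. T k $$ (i, j))"
  using assms by (subst mats_sum_index) (auto simp: o_def interv_sum_list_conv_sum_set_nat)

lemma mats_prod_carrier:
  assumes "\<And>A. A \<in> set As \<Longrightarrow> A \<in> carrier_mat n n"
  shows "mats_prod n As \<in> carrier_mat n n"
  using assms by (induction As) (auto simp: mats_prod_def intro: mult_carrier_mat[of _ n n])

lemma mats_prod_Cons: "mats_prod n (A # As) = A * mats_prod n As"
  by (simp add: mats_prod_def)

lemma mats_prod_snoc:
  assumes "\<And>A. A \<in> set As \<Longrightarrow> A \<in> carrier_mat n n" and B: "B \<in> carrier_mat n n"
  shows "mats_prod n (As @ [B]) = mats_prod n As * B"
  using assms(1)
proof (induction As)
  case Nil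
  then show ?case using B by (simp add: mats_prod_def)
next
  case (Cons A As)
  then have "A \<in> carrier_mat n n" "mats_prod n As \<in> carrier_mat n n"
    by (auto intro: mats_prod_carrier)
  then show ?case
    using Cons B by (simp add: mats_prod_Cons assoc_mult_mat[of A n n _ n _ n])
qed

text \<open>The pieces correspond to the three summands of \<open>diff_mat\<close> and
  \<open>udiff_mat\<close>, with \<open>k\<close> standing for the coefficient index
  \<open>j = k - 1\<close>.\<close>

lemma sum_atMost_split_two:
  fixes f :: "nat \<Rightarrow> 'a::comm_monoid_add"
  shows "(\<Sum>k\<le>q + 1. f k) = f 0 + f 1 + (\<Sum>j = 1..<q + 1. f (Suc j))"
proof -
  have "(\<Sum>k\<le>q + 1. f k) = (\<Sum>k<Suc (Suc q). f k)"
    by (simp add: lessThan_Suc_atMost)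
  also have "\<dots> = f 0 + (f 1 + (\<Sum>j<q. f (Suc (Suc j))))"
    by (simp only: sum.lessThan_Suc_shift) simp
  also have "(\<Sum>j<q. f (Suc (Suc j))) = (\<Sum>j = 1..<q + 1. f (Suc j))"
    by (rule sum.reindex_bij_witness[of _ "\<lambda>j. j - 1" Suc]) auto
  finally show ?thesis by (simp add: add.assoc)
qed

lemma add_mat_index3:
  assumes "A \<in> carrier_mat n n" "B \<in> carrier_mat n n" "C \<in> carrier_mat n n" "i < n" "j < n"
  shows "(A + B + C) $$ (i, j) = A $$ (i, j) + B $$ (i, j) + C $$ (i, j)"
  using assms by simp

lemma mat_diag_mult_index:
  "A \<in> carrier_mat n n \<Longrightarrow> i < n \<Longrightarrow> j < n \<Longrightarrow> (mat_diag n f * A) $$ (i, j) = f i * A $$ (i, j)"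
  by (simp add: mat_diag_mult_left)

lemma mult_mat_diag_index:
  "A \<in> carrier_mat n n \<Longrightarrow> i < n \<Longrightarrow> j < n \<Longrightarrow> (A * mat_diag n f) $$ (i, j) = A $$ (i, j) * f j"
  by (simp add: mat_diag_mult_right)

lemma mat_cong:
  assumes "\<And>i j. i < m \<Longrightarrow> j < n \<Longrightarrow> f i j = g i j"
  shows "Matrix.mat m n (\<lambda>(i, j). f i j) = Matrix.mat m n (\<lambda>(i, j). g i j)"
  by (rule eq_matI) (use assms in auto)

lemma det_minus_scalar:
  fixes z :: "'a::comm_ring_1"
  assumes M: "M \<in> carrier_mat n n"
  shows "Determinant.det (Matrix.mat n n (\<lambda>(i, j). M $$ (i, j) - (if i = j then z else 0))) =
    (- 1) ^ n * Determinant.det (z \<cdot>\<^sub>m 1\<^sub>m n - M)"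
proof -
  have "Matrix.mat n n (\<lambda>(i, j). M $$ (i, j) - (if i = j then z else 0)) =
      (- 1) \<cdot>\<^sub>m (z \<cdot>\<^sub>m 1\<^sub>m n - M)"
    by (rule eq_matI) (use M in auto)
  then show ?thesis using M by (simp add: det_smult)
qed

lemma minus_one_power_cancel: "(- 1) ^ n * (a * ((- 1) ^ n * b)) = a * (b :: 'a::comm_ring_1)"
  by (subst mult.left_commute) simp

section \<open>Ladder matrices as companion matrices\<close>

lemma ladder_eq_companion:
  "ladder d c \<gamma> N z = companion d
    (\<lambda>k. cst (1 / \<gamma> N) * ((if k = d then z else 0) - cst (c (int d - int k) N)))"
  unfolding ladder_def companion_def by (rule refl)

lemma flip_uladder:
  "flip_mat (d + 1) (uladder d c \<gamma> N z) = companion d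
    (\<lambda>k. cst (1 / \<gamma> (N - 1)) * ((if k = d then z else 0) - cst (c (int d - int k) (N + d - k))))"
  by (rule eq_matI) (auto simp: uladder_def companion_def flip_mat_def of_nat_diff)

lemma uladder_carrier: "uladder d c \<gamma> N z \<in> carrier_mat (d + 1) (d + 1)"
  by (simp add: uladder_def)

lemma ladder_carrier: "ladder d c \<gamma> N z \<in> carrier_mat (d + 1) (d + 1)"
  by (simp add: ladder_def)

lemma mat_inv_companion:
  fixes \<rho> :: "nat \<Rightarrow> 'a::comm_ring_1"
  assumes "\<rho> 0 * \<kappa> = 1"
  shows "mat_inv (companion p \<rho>) \<in> carrier_mat (p + 1) (p + 1)"
    and "companion p \<rho> * mat_inv (companion p \<rho>) = 1\<^sub>m (p + 1)"
  using companion_inverse_exists[of \<rho> \<kappa> p] assms mat_inv_eqI[OF companion_carrier, of _ p \<rho>]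
  by metis+

text \<open>The flip is an involutive antiautomorphism fixing the identity, so it carries the
  inverse of the companion matrix to an inverse of \<open>U\<close>.\<close>

lemma mat_inv_flip_companion:
  fixes \<rho> :: "nat \<Rightarrow> 'a::comm_ring_1"
  assumes "\<rho> 0 * \<kappa> = 1" and U: "U \<in> carrier_mat (p + 1) (p + 1)"
    and flip: "flip_mat (p + 1) U = companion p \<rho>"
  shows "mat_inv U \<in> carrier_mat (p + 1) (p + 1)" and "mat_inv U * U = 1\<^sub>m (p + 1)"
proof -
  obtain B where B: "B \<in> carrier_mat (p + 1) (p + 1)"
    and inv: "flip_mat (p + 1) U * B = 1\<^sub>m (p + 1)" "B * flip_mat (p + 1) U = 1\<^sub>m (p + 1)"
    unfolding flip using companion_inverse_exists[of \<rho> \<kappa> p] assms(1) by metis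
  have "flip_mat (p + 1) B * U = 1\<^sub>m (p + 1)" "U * flip_mat (p + 1) B = 1\<^sub>m (p + 1)"
    using arg_cong[OF inv(1), of "flip_mat (p + 1)"] arg_cong[OF inv(2), of "flip_mat (p + 1)"] B U
    by (simp_all only: flip_mat_mult[OF flip_mat_carrier B] flip_mat_mult[OF B flip_mat_carrier]
        flip_mat_flip_mat[OF U] flip_mat_one)
  then show "mat_inv U \<in> carrier_mat (p + 1) (p + 1)" "mat_inv U * U = 1\<^sub>m (p + 1)"
    using mat_inv_eqI[OF U flip_mat_carrier] by (simp_all only: flip_mat_carrier)
qed

section \<open>Two evaluations of the Sylvester determinant\<close>

lemma companion_row:
  fixes g a :: complex and x :: bipoly
  assumes "g \<noteq> 0"
  shows "cst a - x = - (cst g * (cst (1 / g) * (x - cst a)))"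
proof -
  have "cst g * cst (1 / g) = 1" using assms by (simp add: one_pCons)
  then have "cst g * (cst (1 / g) * (x - cst a)) = x - cst a"
    by (simp only: mult.assoc[symmetric] mult_1_left)
  then show ?thesis by (simp only: minus_diff_eq)
qed

text \<open>Let \<open>c j n\<close> stand in place \<open>(n, n - j)\<close> and
  \<open>c' j (n + j)\<close> in place \<open>(n, n + j)\<close> of two band matrices. The columns
  of the Sylvester matrix are the indices \<open>N - d - 1\<close> to \<open>N + d'\<close>; the
  \<open>r\<close>-rows are rows \<open>N - 1\<close> to \<open>N - 1 + d'\<close> of the first
  matrix minus \<open>z\<close>, the \<open>s\<close>-rows are rows \<open>N - d\<close> to
  \<open>N\<close> of the second minus \<open>z'\<close>. Elimination of the former leaves the
  window from \<open>N - d\<close> to \<open>N\<close>.\<close>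

lemma det_sylv_diff_mat:
  fixes c c' :: "int \<Rightarrow> nat \<Rightarrow> complex" and z z' :: bipoly
  assumes N: "d + 1 \<le> N" and d: "1 \<le> d"
    and \<gamma>: "\<And>n. \<gamma> n \<noteq> 0" and c: "\<And>n. c (- 1) n = \<gamma> n" and top: "c (int d) (N - 1) \<noteq> 0"
    and r: "\<And>i k. r i k = cst (c (int d - int k) (N - 1 + i)) - (if k = d then z else 0)"
    and s: "\<And>i k. s i k = cst (c' (int k - 1) (N + i + k - d - 1)) - (if k = 1 then z' else 0)"
  shows "Determinant.det (sylv d d' r s) = cst (c (int d) (N - 1)) *
    (\<Prod>i = 1..d'. cst (\<gamma> (N - 1 + i))) *
    Determinant.det (z' \<cdot>\<^sub>m 1\<^sub>m (d + 1) - diff_mat d d' c c' \<gamma> N z)"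
proof -
  define \<rho> where "\<rho> n k = cst (1 / \<gamma> n) * ((if k = d then z else 0) - cst (c (int d - int k) n))"
    for n k
  \<comment> \<open>\<open>A 0\<close> moves the window one place back by an inverse ladder matrix;
    \<open>A (Suc j)\<close> moves it forward \<open>j\<close> times.\<close>
  define A where "A j = (case j of 0 \<Rightarrow> mat_inv (ladder d c \<gamma> (N - 1) z)
    | Suc j \<Rightarrow> mats_prod (d + 1) (map (\<lambda>i. ladder d c \<gamma> (N + i) z) (rev [0..<j])))" for j
  let ?D = "diff_mat d d' c c' \<gamma> N z"
  have ladder: "ladder d c \<gamma> n z = companion d (\<rho> n)" for n
    unfolding ladder_eq_companion \<rho>_def by (rule refl)
  \<comment> \<open>As \<open>1 \<le> d\<close>, the variable \<open>z\<close> does not occur in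
    column 0. The corner entry is thus a nonzero constant, a unit even among polynomials.\<close>
  have "\<rho> (N - 1) 0 * cst (- \<gamma> (N - 1) / c (int d) (N - 1)) = 1"
    using d top \<gamma>[of "N - 1"] by (simp add: \<rho>_def one_pCons)
  note inv = mat_inv_companion[of "\<rho> (N - 1)", OF this, of d, folded ladder]
  have A: "A j \<in> carrier_mat (d + 1) (d + 1)" for j
  proof (cases j)
    case 0
    then show ?thesis using inv(1) by (simp add: A_def)
  next
    case (Suc i)
    then show ?thesis
      unfolding A_def by (auto simp only: nat.case set_map intro!: mats_prod_carrier ladder_carrier)
  qed
  have A_1: "A 1 = 1\<^sub>m (d + 1)" by (simp add: A_def mats_prod_def)
  have A_Suc: "A (Suc j) = companion d (\<rho> (N - 1 + j)) * A j" for j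
  proof (cases j)
    case 0
    then show ?thesis
      using inv(2) by (simp add: A_def mats_prod_def ladder)
  next
    case (Suc i)
    then show ?thesis
      using N by (simp add: A_def mats_prod_Cons ladder)
  qed
  have det: "Determinant.det (sylv d d' r s) =
      (- 1) ^ (d + 1) * r 0 0 * (\<Prod>i = 1..d'. r i (d + 1)) * Determinant.det
      (Matrix.mat (d + 1) (d + 1) (\<lambda>(i, w). \<Sum>k\<le>d' + 1. s i k * A k $$ (i, w)))"
  proof (rule det_sylv_companion[where \<rho> = "\<lambda>j. \<rho> (N - 1 + j)"])
    fix j k
    have "r j (d + 1) = cst (\<gamma> (N - 1 + j))" by (simp add: r c)
    then show "r j k = - (r j (d + 1) * \<rho> (N - 1 + j) k)"
      unfolding r[of j k] \<rho>_def by (simp only: companion_row[OF \<gamma>])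
  qed (use A A_1 A_Suc in auto)
  have D: "?D \<in> carrier_mat (d + 1) (d + 1)"
    unfolding diff_mat_def diag_coeffs_def
    using mats_prod_carrier ladder_carrier inv(1)
    by (auto intro!: add_carrier_mat mult_carrier_mat[of _ _ "d + 1"] mats_sum_carrier
        mats_prod_carrier ladder_carrier)
  have D_index: "?D $$ (i, w) =
      (\<Sum>k\<le>d' + 1. cst (c' (int k - 1) (N + i + k - d - 1)) * A k $$ (i, w))"
    if "i < d + 1" "w < d + 1" for i w
  proof -
    define T where "T j = diag_coeffs d c' (int j) N * A (Suc j)" for j
    have diag: "(diag_coeffs d c' (int k - 1) N * A k) $$ (i, w) =
        cst (c' (int k - 1) (N + i + k - d - 1)) * A k $$ (i, w)" for k
    proof -
      have "nat (int N + (int k - 1) - int d + int i) = N + i + k - d - 1" using N by simp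
      then show ?thesis
        unfolding diag_coeffs_def by (simp only: mat_diag_mult_index[OF A that])
    qed
    have T: "T j \<in> carrier_mat (d + 1) (d + 1)" for j
      using A unfolding T_def diag_coeffs_def by (intro mult_carrier_mat[of _ _ "d + 1"]) auto
    have D_eq: "?D = diag_coeffs d c' (- 1) N * A 0 + diag_coeffs d c' 0 N +
        mats_sum (d + 1) (map T [1..<d' + 1])"
      unfolding diff_mat_def T_def by (simp add: A_def)
    have "?D $$ (i, w) = (diag_coeffs d c' (- 1) N * A 0) $$ (i, w) +
        diag_coeffs d c' 0 N $$ (i, w) + mats_sum (d + 1) (map T [1..<d' + 1]) $$ (i, w)"
    proof -
      have "mats_sum (d + 1) (map T [1..<d' + 1]) \<in> carrier_mat (d + 1) (d + 1)"
        using T by (intro mats_sum_carrier) auto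
      then show ?thesis
        unfolding D_eq diag_coeffs_def
        by (intro add_mat_index3[OF mult_carrier_mat[OF mat_diag_dim A] mat_diag_dim] that)
    qed
    also have "mats_sum (d + 1) (map T [1..<d' + 1]) $$ (i, w) = (\<Sum>j = 1..<d' + 1. T j $$ (i, w))"
      using T that by (intro mats_sum_map_index)
    also have "diag_coeffs d c' 0 N = diag_coeffs d c' 0 N * A 1"
      unfolding A_1 diag_coeffs_def by (rule right_mult_one_mat[OF mat_diag_dim, symmetric])
    finally show ?thesis
      unfolding sum_atMost_split_two using diag[of 0] diag[of 1] diag[of "Suc _"]
      by (simp add: T_def)
  qed
  have "Matrix.mat (d + 1) (d + 1) (\<lambda>(i, w). \<Sum>k\<le>d' + 1. s i k * A k $$ (i, w)) =
      Matrix.mat (d + 1) (d + 1) (\<lambda>(i, w). ?D $$ (i, w) - (if i = w then z' else 0))"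
  proof (rule mat_cong)
    fix i w assume iw: "i < d + 1" "w < d + 1"
    have "(\<Sum>k\<le>d' + 1. s i k * A k $$ (i, w)) =
        ?D $$ (i, w) - (\<Sum>k\<le>d' + 1. if k = 1 then z' * A k $$ (i, w) else 0)"
      unfolding s D_index[OF iw] sum_subtractf[symmetric]
      by (rule sum.cong) (auto simp: left_diff_distrib)
    \<comment> \<open>The variable \<open>z'\<close> multiplies only \<open>A 1\<close>, which is
      the identity, so it appears exactly on the diagonal.\<close>
    also have "(\<Sum>k\<le>d' + 1. if k = 1 then z' * A k $$ (i, w) else 0) = (if i = w then z' else 0)"
      using iw A_1 by (subst sum.delta) auto
    finally show "(\<Sum>k\<le>d' + 1. s i k * A k $$ (i, w)) = ?D $$ (i, w) - (if i = w then z' else 0)" .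
  qed
  then have "Determinant.det (sylv d d' r s) = (- 1) ^ (d + 1) * ((r 0 0 * (\<Prod>i = 1..d'. r i (d + 1))) *
      ((- 1) ^ (d + 1) * Determinant.det (z' \<cdot>\<^sub>m 1\<^sub>m (d + 1) - ?D)))"
    by (simp only: det det_minus_scalar[OF D] mult.assoc)
  also have "\<dots> = r 0 0 * (\<Prod>i = 1..d'. r i (d + 1)) *
      Determinant.det (z' \<cdot>\<^sub>m 1\<^sub>m (d + 1) - ?D)"
    by (rule minus_one_power_cancel)
  also have "r 0 0 = cst (c (int d) (N - 1))"
    using d by (simp add: r)
  also have "(\<Prod>i = 1..d'. r i (d + 1)) = (\<Prod>i = 1..d'. cst (\<gamma> (N - 1 + i)))"
    by (rule prod.cong) (simp_all add: r c)
  finally show ?thesis .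
qed

text \<open>The indices now run downwards and the placements are exchanged:
  \<open>c j (n + j)\<close> stands in place \<open>(n, n + j)\<close> and \<open>c' j n\<close> in
  place \<open>(n, n - j)\<close>. Columns go from \<open>N + d\<close> down to
  \<open>N - d' - 1\<close>, the \<open>r\<close>-rows are rows \<open>N\<close> down to
  \<open>N - d'\<close>, the \<open>s\<close>-rows rows \<open>N - 1 + d\<close> down to
  \<open>N - 1\<close>. The window left over is \<open>N - 1 + d\<close> down to
  \<open>N - 1\<close>.\<close>

lemma det_sylv_udiff_mat:
  fixes c c' :: "int \<Rightarrow> nat \<Rightarrow> complex" and z z' :: bipoly
  assumes N: "d' + 1 \<le> N" and d: "1 \<le> d"
    and \<gamma>: "\<And>n. \<gamma> n \<noteq> 0" and c: "\<And>n. c (- 1) n = \<gamma> n" and top: "c (int d) (N + d) \<noteq> 0"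
    and r: "\<And>i k. r i k = cst (c (int d - int k) (N + d - i - k)) - (if k = d then z else 0)"
    and s: "\<And>i k. s i k = cst (c' (int k - 1) (N - 1 + d - i)) - (if k = 1 then z' else 0)"
  shows "Determinant.det (sylv d d' r s) = cst (c (int d) (N + d)) *
    (\<Prod>i = 1..d'. cst (\<gamma> (N - 1 - i))) *
    Determinant.det (z' \<cdot>\<^sub>m 1\<^sub>m (d + 1) - udiff_mat d d' c c' \<gamma> N z)"
proof -
  define \<rho> where "\<rho> n k = cst (1 / \<gamma> (n - 1)) *
    ((if k = d then z else 0) - cst (c (int d - int k) (n + d - k)))" for n k
  define U where "U j = (case j of 0 \<Rightarrow> mat_inv (uladder d c \<gamma> N z)
    | Suc j \<Rightarrow> mats_prod (d + 1) (map (\<lambda>i. uladder d c \<gamma> (N - i) z) [1..<j + 1]))" for j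
  \<comment> \<open>The products \<open>U j\<close> grow by a factor on the right; their flips obey
    the companion recursion from the left.\<close>
  define A where "A j = flip_mat (d + 1) (U j)" for j
  let ?D = "udiff_mat d d' c c' \<gamma> N z"
  have uladder: "flip_mat (d + 1) (uladder d c \<gamma> n z) = companion d (\<rho> n)" for n
    unfolding flip_uladder \<rho>_def by (rule refl)
  have "\<rho> N 0 * cst (- \<gamma> (N - 1) / c (int d) (N + d)) = 1"
    using d top \<gamma>[of "N - 1"] by (simp add: \<rho>_def one_pCons)
  note inv = mat_inv_flip_companion[of "\<rho> N", OF this uladder_carrier uladder]
  have U: "U j \<in> carrier_mat (d + 1) (d + 1)" for j
  proof (cases j)
    case 0
    then show ?thesis using inv(1) by (simp add: U_def)
  next
    case (Suc i)
    then show ?thesis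
      unfolding U_def by (auto simp only: nat.case set_map intro!: mats_prod_carrier uladder_carrier)
  qed
  have U_1: "U 1 = 1\<^sub>m (d + 1)" by (simp add: U_def mats_prod_def)
  have U_Suc: "U (Suc j) = U j * uladder d c \<gamma> (N - j) z" for j
  proof (cases j)
    case 0
    then show ?thesis
      using inv(2) by (simp add: U_def mats_prod_def)
  next
    case (Suc i)
    have "mats_prod (d + 1) (map (\<lambda>i. uladder d c \<gamma> (N - i) z) [1..<i + 1] @
        [uladder d c \<gamma> (N - j) z]) =
      mats_prod (d + 1) (map (\<lambda>i. uladder d c \<gamma> (N - i) z) [1..<i + 1]) *
        uladder d c \<gamma> (N - j) z"
      by (rule mats_prod_snoc) (auto simp only: set_map intro!: uladder_carrier)
    then show ?thesis using Suc by (simp add: U_def)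
  qed
  have A: "A j \<in> carrier_mat (d + 1) (d + 1)" for j
    unfolding A_def by (rule flip_mat_carrier)
  have A_1: "A 1 = 1\<^sub>m (d + 1)"
    unfolding A_def U_1 by (rule flip_mat_one)
  have A_Suc: "A (Suc j) = companion d (\<rho> (N - j)) * A j" for j
    unfolding A_def U_Suc by (simp only: flip_mat_mult[OF U uladder_carrier] uladder)
  have det: "Determinant.det (sylv d d' r s) =
      (- 1) ^ (d + 1) * r 0 0 * (\<Prod>i = 1..d'. r i (d + 1)) * Determinant.det
      (Matrix.mat (d + 1) (d + 1) (\<lambda>(i, w). \<Sum>k\<le>d' + 1. s i k * A k $$ (i, w)))"
  proof (rule det_sylv_companion[where \<rho> = "\<lambda>j. \<rho> (N - j)"])
    fix j k assume "j \<le> d'" "k \<le> d"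
    then have "N + d - j - k = N - j + d - k" using N by simp
    moreover have "r j (d + 1) = cst (\<gamma> (N - j - 1))" by (simp add: r c)
    ultimately show "r j k = - (r j (d + 1) * \<rho> (N - j) k)"
      unfolding r[of j k] \<rho>_def by (simp only: companion_row[OF \<gamma>])
  qed (use A A_1 A_Suc in auto)
  define T where "T j = U (Suc j) * udiag_coeffs d c' (int j) (N - 1)" for j
  have T: "T j \<in> carrier_mat (d + 1) (d + 1)" for j
    using U unfolding T_def udiag_coeffs_def by (intro mult_carrier_mat[of _ _ "d + 1"]) auto
  have sum_T: "mats_sum (d + 1) (map T [1..<d' + 1]) \<in> carrier_mat (d + 1) (d + 1)"
    using T by (intro mats_sum_carrier) auto
  have D_eq: "?D = U 0 * udiag_coeffs d c' (- 1) (N - 1) + udiag_coeffs d c' 0 (N - 1) +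
      mats_sum (d + 1) (map T [1..<d' + 1])"
    unfolding udiff_mat_def T_def by (simp add: U_def)
  have D: "?D \<in> carrier_mat (d + 1) (d + 1)"
    unfolding D_eq using sum_T by (rule add_carrier_mat)
  have D_index: "?D $$ (w, i) =
      (\<Sum>k\<le>d' + 1. cst (c' (int k - 1) (N - 1 + i)) * U k $$ (w, i))"
    if "i < d + 1" "w < d + 1" for i w
  proof -
    have diag: "(U k * udiag_coeffs d c' (int k - 1) (N - 1)) $$ (w, i) =
        cst (c' (int k - 1) (N - 1 + i)) * U k $$ (w, i)" for k
      unfolding udiag_coeffs_def by (simp only: mult_mat_diag_index[OF U that(2,1)] mult.commute)
    have "?D $$ (w, i) = (U 0 * udiag_coeffs d c' (- 1) (N - 1)) $$ (w, i) +
        udiag_coeffs d c' 0 (N - 1) $$ (w, i) + mats_sum (d + 1) (map T [1..<d' + 1]) $$ (w, i)"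
      unfolding D_eq udiag_coeffs_def
      by (intro add_mat_index3[OF mult_carrier_mat[OF U mat_diag_dim] mat_diag_dim sum_T] that)
    also have "mats_sum (d + 1) (map T [1..<d' + 1]) $$ (w, i) = (\<Sum>j = 1..<d' + 1. T j $$ (w, i))"
      using T that by (intro mats_sum_map_index)
    also have "udiag_coeffs d c' 0 (N - 1) = U 1 * udiag_coeffs d c' 0 (N - 1)"
      unfolding U_1 udiag_coeffs_def by (rule left_mult_one_mat[OF mat_diag_dim, symmetric])
    finally show ?thesis
      unfolding sum_atMost_split_two using diag[of 0] diag[of 1] diag[of "Suc _"]
      by (simp add: T_def)
  qed
  have "Matrix.mat (d + 1) (d + 1) (\<lambda>(i, w). \<Sum>k\<le>d' + 1. s i k * A k $$ (i, w)) =
      Matrix.mat (d + 1) (d + 1)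
        (\<lambda>(i, w). flip_mat (d + 1) ?D $$ (i, w) - (if i = w then z' else 0))"
  proof (rule mat_cong)
    fix i w assume iw: "i < d + 1" "w < d + 1"
    have "(\<Sum>k\<le>d' + 1. s i k * A k $$ (i, w)) =
        (\<Sum>k\<le>d' + 1. cst (c' (int k - 1) (N - 1 + (d - i))) * U k $$ (d - w, d - i)) -
        (\<Sum>k\<le>d' + 1. if k = 1 then z' * A k $$ (i, w) else 0)"
      unfolding s sum_subtractf[symmetric]
      by (rule sum.cong) (use iw in \<open>auto simp: left_diff_distrib A_def\<close>)
    also have "(\<Sum>k\<le>d' + 1. cst (c' (int k - 1) (N - 1 + (d - i))) * U k $$ (d - w, d - i)) =
        flip_mat (d + 1) ?D $$ (i, w)"
      using iw by (subst D_index[symmetric]) auto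
    also have "(\<Sum>k\<le>d' + 1. if k = 1 then z' * A k $$ (i, w) else 0) = (if i = w then z' else 0)"
      using iw A_1 by (subst sum.delta) auto
    finally show "(\<Sum>k\<le>d' + 1. s i k * A k $$ (i, w)) =
        flip_mat (d + 1) ?D $$ (i, w) - (if i = w then z' else 0)" .
  qed
  then have "Determinant.det (sylv d d' r s) = (- 1) ^ (d + 1) * ((r 0 0 * (\<Prod>i = 1..d'. r i (d + 1))) *
      ((- 1) ^ (d + 1) * Determinant.det (z' \<cdot>\<^sub>m 1\<^sub>m (d + 1) - flip_mat (d + 1) ?D)))"
    by (simp only: det det_minus_scalar[OF flip_mat_carrier] mult.assoc)
  also have "\<dots> = r 0 0 * (\<Prod>i = 1..d'. r i (d + 1)) *
      Determinant.det (z' \<cdot>\<^sub>m 1\<^sub>m (d + 1) - flip_mat (d + 1) ?D)"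
    by (rule minus_one_power_cancel)
  \<comment> \<open>Scalar matrices are fixed by the flip, so the characteristic determinant of the
    flipped matrix is that of the original one.\<close>
  also have "z' \<cdot>\<^sub>m 1\<^sub>m (d + 1) - flip_mat (d + 1) ?D =
      flip_mat (d + 1) (z' \<cdot>\<^sub>m 1\<^sub>m (d + 1) - ?D)"
    by (rule eq_matI) (use D in \<open>auto simp: flip_mat_def\<close>)
  also have "Determinant.det \<dots> = Determinant.det (z' \<cdot>\<^sub>m 1\<^sub>m (d + 1) - ?D)"
    by (rule det_flip_mat) (rule minus_carrier_mat[OF D])
  also have "r 0 0 = cst (c (int d) (N + d))"
    using d by (simp add: r)
  also have "(\<Prod>i = 1..d'. r i (d + 1)) = (\<Prod>i = 1..d'. cst (\<gamma> (N - 1 - i)))"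
    by (rule prod.cong) (simp_all add: r c)
  finally show ?thesis .
qed

section \<open>Comparison of the two evaluations\<close>

lemma sylv_cong:
  assumes "\<And>i k. i \<le> q \<Longrightarrow> k \<le> p + 1 \<Longrightarrow> r i k = r' i k"
    and "\<And>i k. i \<le> p \<Longrightarrow> k \<le> q + 1 \<Longrightarrow> s i k = s' i k"
  shows "sylv p q r s = sylv p q r' s'"
  by (rule eq_matI) (use assms in \<open>auto simp: sylv_def band_def\<close>)

lemma prod_cst: "(\<Prod>i\<in>I. cst (f i)) = cst (\<Prod>i\<in>I. f i)"
  by (induction I rule: infinite_finite_induct) (simp_all add: one_pCons)

text \<open>Both determinants come from one Sylvester matrix, eliminated directly and after a
  half-turn. The products of \<gamma> telescope, and together with the ratios in the outermost
  coefficients they give the same factor on both sides. Only \<kappa> and \<kappa>' survive.\<close>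

lemma spectral_duality:
  fixes c c' :: "int \<Rightarrow> nat \<Rightarrow> complex" and g :: "nat \<Rightarrow> complex" and \<kappa> \<kappa>' :: complex
  assumes N: "d + 1 \<le> N" and d: "1 \<le> d" and d': "1 \<le> d'"
    and g: "\<And>n. g n \<noteq> 0" and \<gamma>: "\<And>n. \<gamma> n = g (n + 1) / g n"
    and c: "\<And>n. c (- 1) n = \<gamma> n" and c': "\<And>n. c' (- 1) n = \<gamma> n"
    and top: "\<And>n. d \<le> n \<Longrightarrow> c (int d) n = \<kappa> * (g n / g (n - d))"
    and top': "\<And>n. d' \<le> n \<Longrightarrow> c' (int d') n = \<kappa>' * (g n / g (n - d'))"
    and \<kappa>: "\<kappa> \<noteq> 0" and \<kappa>': "\<kappa>' \<noteq> 0"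
  shows "cst \<kappa> * Determinant.det (z' \<cdot>\<^sub>m 1\<^sub>m (d + 1) - diff_mat d d' c c' \<gamma> N z) =
    cst \<kappa>' * Determinant.det (z \<cdot>\<^sub>m 1\<^sub>m (d' + 1) - udiff_mat d' d c' c \<gamma> N z')"
proof -
  define r where "r i k = cst (c (int d - int k) (N - 1 + i)) - (if k = d then z else 0)" for i k
  define s where "s i k = cst (c' (int k - 1) (N + i + k - d - 1)) - (if k = 1 then z' else 0)" for i k
  define r' where "r' i k = cst (c' (int d' - int k) (N + d' - i - k)) - (if k = d' then z' else 0)" for i k
  define s' where "s' i k = cst (c (int k - 1) (N - 1 + d' - i)) - (if k = 1 then z else 0)" for i k
  let ?D = "Determinant.det (z' \<cdot>\<^sub>m 1\<^sub>m (d + 1) - diff_mat d d' c c' \<gamma> N z)"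
  let ?E = "Determinant.det (z \<cdot>\<^sub>m 1\<^sub>m (d' + 1) - udiff_mat d' d c' c \<gamma> N z')"
  have \<gamma>0: "\<gamma> n \<noteq> 0" for n using g by (simp add: \<gamma>)
  have tele: "(\<Prod>i = 1..m. \<gamma> (n + i)) = g (n + m + 1) / g (n + 1)" for n m
    using g by (induction m) (simp_all add: \<gamma>)
  have tele': "(\<Prod>i = 1..m. \<gamma> (N - 1 - i)) = g (N - 1) / g (N - 1 - m)" if "m \<le> N - 1" for m
    using that
  proof (induction m)
    case 0
    then show ?case using g by simp
  next
    case (Suc m)
    then have "N - 1 - Suc m + 1 = N - 1 - m" by simp
    then show ?case using Suc g by (simp add: \<gamma>)
  qed
  have "Determinant.det (sylv d d' r s) = cst (c (int d) (N - 1)) *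
      (\<Prod>i = 1..d'. cst (\<gamma> (N - 1 + i))) * ?D"
    by (rule det_sylv_diff_mat[where c = c and \<gamma> = \<gamma>])
      (use N d \<gamma>0 c top[of "N - 1"] g \<kappa> in \<open>auto simp: r_def s_def\<close>)
  also have "(\<Prod>i = 1..d'. cst (\<gamma> (N - 1 + i))) = cst (g (N + d') / g N)"
    unfolding prod_cst tele using N by simp
  also have "c (int d) (N - 1) = \<kappa> * (g (N - 1) / g (N - 1 - d))"
    using N by (intro top) simp
  finally have 1: "Determinant.det (sylv d d' r s) =
      cst (\<kappa> * (g (N - 1) / g (N - 1 - d))) * cst (g (N + d') / g N) * ?D" .
  \<comment> \<open>Reversing all rows and columns exchanges the roles of the two bands.\<close>
  have "sylv d' d r' s' = sylv d' d (\<lambda>i k. s (d - i) (d' + 1 - k)) (\<lambda>i k. r (d' - i) (d + 1 - k))"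
  proof (rule sylv_cong)
    fix i k assume "i \<le> d" "k \<le> d' + 1"
    then have "int (d' + 1 - k) - 1 = int d' - int k" "d' + 1 - k = 1 \<longleftrightarrow> k = d'"
      "N + (d - i) + (d' + 1 - k) - d - 1 = N + d' - i - k"
      using N by linarith+
    then show "r' i k = s (d - i) (d' + 1 - k)" by (simp only: r'_def s_def)
  next
    fix i k assume "i \<le> d'" "k \<le> d + 1"
    then have "int d - int (d + 1 - k) = int k - 1" "d + 1 - k = d \<longleftrightarrow> k = 1"
      "N - 1 + (d' - i) = N - 1 + d' - i"
      using d by linarith+
    then show "s' i k = r (d' - i) (d + 1 - k)" by (simp only: s'_def r_def)
  qed
  then have "Determinant.det (sylv d d' r s) = Determinant.det (sylv d' d r' s')"
    by (simp only: det_sylv_reverse)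
  also have "\<dots> = cst (c' (int d') (N + d')) * (\<Prod>i = 1..d. cst (\<gamma> (N - 1 - i))) * ?E"
    by (rule det_sylv_udiff_mat[where c = c' and \<gamma> = \<gamma>])
      (use N d' \<gamma>0 c' top'[of "N + d'"] g \<kappa>' in \<open>auto simp: r'_def s'_def\<close>)
  also have "(\<Prod>i = 1..d. cst (\<gamma> (N - 1 - i))) = cst (g (N - 1) / g (N - 1 - d))"
    unfolding prod_cst using N by (subst tele') auto
  also have "c' (int d') (N + d') = \<kappa>' * (g (N + d') / g N)"
    by (subst top') auto
  finally have 2: "Determinant.det (sylv d d' r s) =
      cst (\<kappa>' * (g (N + d') / g N)) * cst (g (N - 1) / g (N - 1 - d)) * ?E" .
  \<comment> \<open>\<open>K\<close> is the common part of the two pivot products; it is nonzero and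
    cancels in the polynomial domain.\<close>
  define K where "K = g (N - 1) / g (N - 1 - d) * (g (N + d') / g N)"
  have "cst K \<noteq> 0" using g by (simp add: K_def)
  moreover have "cst K * (cst \<kappa> * ?D) = cst K * (cst \<kappa>' * ?E)"
    using 1 2 by (simp add: K_def mult_ac)
  ultimately show ?thesis by (rule mult_left_cancel[THEN iffD1])
qed

section \<open>The outermost recursion coefficients\<close>

text \<open>Inner integrals are known to exist only over interior points of the outer contour. The
  two endpoint parameters form a finite set, so identities between inner integrals still pass to the
  outer one.\<close>

lemma has_contour_integral_cong_interior:
  assumes "\<And>x. x \<in> g ` {0<..<1} \<Longrightarrow> f x = f' x"
  shows "(f has_contour_integral i) g \<longleftrightarrow> (f' has_contour_integral i) g"
  unfolding has_contour_integral_def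
  by (rule has_integral_spike_finite_eq[of "{0, 1}"]) (use assms in \<open>auto simp: less_le\<close>)

lemma iterated_integral_has_contour_integral:
  assumes "iterated_integrable \<Gamma>x \<Gamma>y f"
  shows "\<And>x. x \<in> \<Gamma>x ` {0<..<1} \<Longrightarrow>
      ((\<lambda>y. f x y) has_contour_integral contour_integral \<Gamma>y (\<lambda>y. f x y)) \<Gamma>y"
    and "((\<lambda>x. contour_integral \<Gamma>y (\<lambda>y. f x y)) has_contour_integral
      iterated_integral \<Gamma>x \<Gamma>y f) \<Gamma>x"
  using assms by (auto simp: iterated_integrable_def iterated_integral_def
      intro!: has_contour_integral_integral)

lemma iterated_integral_add:
  assumes "iterated_integrable \<Gamma>x \<Gamma>y f" "iterated_integrable \<Gamma>x \<Gamma>y g"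
  shows "iterated_integral \<Gamma>x \<Gamma>y (\<lambda>x y. f x y + g x y) =
    iterated_integral \<Gamma>x \<Gamma>y f + iterated_integral \<Gamma>x \<Gamma>y g"
proof -
  have "((\<lambda>x. contour_integral \<Gamma>y (\<lambda>y. f x y) + contour_integral \<Gamma>y (\<lambda>y. g x y))
      has_contour_integral iterated_integral \<Gamma>x \<Gamma>y f + iterated_integral \<Gamma>x \<Gamma>y g) \<Gamma>x"
    by (intro has_contour_integral_add iterated_integral_has_contour_integral(2) assms)
  moreover have "contour_integral \<Gamma>y (\<lambda>y. f x y) + contour_integral \<Gamma>y (\<lambda>y. g x y) =
      contour_integral \<Gamma>y (\<lambda>y. f x y + g x y)" if "x \<in> \<Gamma>x ` {0<..<1}" for x
    using has_contour_integral_add[OF iterated_integral_has_contour_integral(1)[OF assms(1) that]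
        iterated_integral_has_contour_integral(1)[OF assms(2) that]]
    by (rule contour_integral_unique[symmetric])
  ultimately have "((\<lambda>x. contour_integral \<Gamma>y (\<lambda>y. f x y + g x y)) has_contour_integral
      iterated_integral \<Gamma>x \<Gamma>y f + iterated_integral \<Gamma>x \<Gamma>y g) \<Gamma>x"
    by (subst (asm) has_contour_integral_cong_interior)
  then show ?thesis
    unfolding iterated_integral_def by (rule contour_integral_unique)
qed

lemma iterated_integral_lmul:
  assumes "iterated_integrable \<Gamma>x \<Gamma>y f"
  shows "iterated_integral \<Gamma>x \<Gamma>y (\<lambda>x y. c * f x y) = c * iterated_integral \<Gamma>x \<Gamma>y f"
proof -
  have "((\<lambda>x. c * contour_integral \<Gamma>y (\<lambda>y. f x y)) has_contour_integral
      c * iterated_integral \<Gamma>x \<Gamma>y f) \<Gamma>x"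
    by (intro has_contour_integral_lmul iterated_integral_has_contour_integral(2) assms)
  moreover have "c * contour_integral \<Gamma>y (\<lambda>y. f x y) = contour_integral \<Gamma>y (\<lambda>y. c * f x y)"
    if "x \<in> \<Gamma>x ` {0<..<1}" for x
    using has_contour_integral_lmul[OF iterated_integral_has_contour_integral(1)[OF assms that]]
    by (rule contour_integral_unique[symmetric])
  ultimately have "((\<lambda>x. contour_integral \<Gamma>y (\<lambda>y. c * f x y)) has_contour_integral
      c * iterated_integral \<Gamma>x \<Gamma>y f) \<Gamma>x"
    by (subst (asm) has_contour_integral_cong_interior)
  then show ?thesis
    unfolding iterated_integral_def by (rule contour_integral_unique)
qed

section \<open>The potential as a polynomial\<close>

definition potential_poly :: "nat \<Rightarrow> (nat \<Rightarrow> complex) \<Rightarrow> complex poly" where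
  "potential_poly d u = (\<Sum>K = 1..d + 1. Polynomial.monom (u K / of_nat K) K)"

lemma potential_eq_poly: "potential d u = poly (potential_poly d u)"
  by (rule ext) (simp add: potential_def potential_poly_def poly_sum poly_monom del: sum.cl_ivl_Suc)

lemma coeff_pderiv_potential_poly: "coeff (pderiv (potential_poly d u)) d = u (d + 1)"
  by (simp add: coeff_pderiv potential_poly_def coeff_sum del: of_nat_Suc)

lemma degree_pderiv_potential_poly:
  assumes "u (d + 1) \<noteq> 0"
  shows "degree (pderiv (potential_poly d u)) = d"
proof (rule order_antisym)
  have "degree (potential_poly d u) \<le> d + 1"
    unfolding potential_poly_def
    by (intro degree_sum_le) (auto intro: order_trans[OF degree_monom_le])
  then show "degree (pderiv (potential_poly d u)) \<le> d"
    by (simp add: degree_pderiv)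
  show "d \<le> degree (pderiv (potential_poly d u))"
    by (rule le_degree) (simp only: coeff_pderiv_potential_poly assms not_False_eq_True)
qed

lemma coeff_mult_pderiv_potential_poly:
  assumes "u (d + 1) \<noteq> 0"
  shows "coeff (p * pderiv (potential_poly d u)) (degree p + d) = lead_coeff p * u (d + 1)"
  using coeff_mult_degree_sum[of p "pderiv (potential_poly d u)"]
  by (simp only: degree_pderiv_potential_poly[of u d, OF assms] coeff_pderiv_potential_poly)

section \<open>Linear functionals on polynomials\<close>

locale linear_functional =
  fixes L :: "complex poly \<Rightarrow> complex"
  assumes add: "L (p + q) = L p + L q"
    and smult: "L (Polynomial.smult a p) = a * L p"
begin

lemma zero: "L 0 = 0"
  using smult[of 0 0] by simp

lemma diff: "L (p - q) = L p - L q"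
  using add[of p "Polynomial.smult (- 1) q"] smult[of "- 1" q] by simp

lemma sum: "L (\<Sum>i\<in>I. f i) = (\<Sum>i\<in>I. L (f i))"
  by (induction I rule: infinite_finite_induct) (simp_all add: zero add)

text \<open>Subtracting a multiple of \<open>\<sigma> k\<close> removes the top coefficient and
  lowers the bound. Bounding the degree through vanishing coefficients makes the zero polynomial the
  base case.\<close>

lemma eq_zero_below:
  assumes \<sigma>: "\<And>n. degree (\<sigma> n) = n" "\<And>n. lead_coeff (\<sigma> n) = 1"
    and orth: "\<And>m. m < n \<Longrightarrow> L (\<sigma> m) = 0"
    and "k \<le> n" "\<And>i. k \<le> i \<Longrightarrow> coeff q i = 0"
  shows "L q = 0"
  using assms(4,5)
proof (induction k arbitrary: q)
  case 0
  then have "q = 0" by (intro poly_eqI) simp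
  then show ?case by (simp add: zero)
next
  case (Suc k)
  define q' where "q' = q - Polynomial.smult (coeff q k) (\<sigma> k)"
  have "L q' = 0"
  proof (rule Suc.IH)
    fix i assume "k \<le> i"
    then show "coeff q' i = 0"
      using Suc.prems(2)[of i] \<sigma>[of k] by (cases "i = k") (auto simp: q'_def coeff_eq_0)
  qed (use Suc.prems in simp)
  moreover have "L q' = L q"
    using Suc.prems(1) by (simp add: q'_def diff smult orth)
  ultimately show ?case by simp
qed

lemma eq_top_coeff:
  assumes \<sigma>: "\<And>n. degree (\<sigma> n) = n" "\<And>n. lead_coeff (\<sigma> n) = 1"
    and orth: "\<And>m. m < n \<Longrightarrow> L (\<sigma> m) = 0"
    and q: "degree q \<le> n"
  shows "L q = coeff q n * L (\<sigma> n)"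
proof -
  have "L (q - Polynomial.smult (coeff q n) (\<sigma> n)) = 0"
  proof (rule eq_zero_below[of \<sigma> n n, OF \<sigma> orth])
    fix i assume "n \<le> i"
    then show "coeff (q - Polynomial.smult (coeff q n) (\<sigma> n)) i = 0"
      using q \<sigma>[of n] by (cases "i = n") (auto simp: coeff_eq_0)
  qed auto
  then show ?thesis by (simp add: diff smult)
qed

end

section \<open>The pairing as a bilinear form\<close>

definition pairing :: "nat \<Rightarrow> nat \<Rightarrow> (nat \<Rightarrow> complex) \<Rightarrow> (nat \<Rightarrow> complex) \<Rightarrow>
    (real \<Rightarrow> complex) \<Rightarrow> (real \<Rightarrow> complex) \<Rightarrow> complex poly \<Rightarrow> complex poly \<Rightarrow> complex" where
  "pairing d1 d2 u v \<Gamma>x \<Gamma>y p q =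
     iterated_integral \<Gamma>x \<Gamma>y (\<lambda>x y. poly p x * poly q y * weight d1 d2 u v x y)"

context
  fixes d1 d2 :: nat and u v :: "nat \<Rightarrow> complex" and \<Gamma>x \<Gamma>y :: "real \<Rightarrow> complex"
  assumes convergent: "\<And>p q :: complex poly. iterated_integrable \<Gamma>x \<Gamma>y
      (\<lambda>x y. poly p x * poly q y * weight d1 d2 u v x y)"
begin

private abbreviation B :: "complex poly \<Rightarrow> complex poly \<Rightarrow> complex" where
  "B \<equiv> pairing d1 d2 u v \<Gamma>x \<Gamma>y"

lemma linear_functional_pairing_left: "linear_functional (\<lambda>p. B p q)"
proof
  show "B (p + p') q = B p q + B p' q" for p p'
    unfolding pairing_def
    by (subst iterated_integral_add[OF convergent convergent, symmetric]) (simp add: distrib_right)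
  show "B (Polynomial.smult a p) q = a * B p q" for a p
    unfolding pairing_def
    by (subst iterated_integral_lmul[OF convergent, symmetric]) (simp add: mult_ac)
qed

lemma linear_functional_pairing_right: "linear_functional (B p)"
proof
  show "B p (q + q') = B p q + B p q'" for q q'
    unfolding pairing_def
    by (subst iterated_integral_add[OF convergent convergent, symmetric])
      (simp add: distrib_left distrib_right)
  show "B p (Polynomial.smult a q) = a * B p q" for a q
    unfolding pairing_def
    by (subst iterated_integral_lmul[OF convergent, symmetric]) (simp add: mult_ac)
qed

text \<open>Differentiating the weight in \<open>y\<close> produces the factor
  \<open>x - V2'(y)\<close>. Since the total derivative integrates to zero, multiplication by
  \<open>x\<close>, written \<open>pCons 0\<close>, moves to the other argument.\<close>

lemma pairing_mult_x:
  assumes by_parts_y: "\<And>p q :: complex poly. iterated_integral \<Gamma>x \<Gamma>y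
      (\<lambda>x y. deriv (\<lambda>y. poly p x * poly q y * weight d1 d2 u v x y) y) = 0"
  shows "B (pCons 0 p) q = B p (q * pderiv (potential_poly d2 v) - pderiv q)"
proof -
  let ?r = "q * pderiv (potential_poly d2 v) - pderiv q"
  have deriv: "deriv (\<lambda>y. poly p x * poly q y * weight d1 d2 u v x y) y =
      poly (pCons 0 p) x * poly q y * weight d1 d2 u v x y +
      (- 1) * (poly p x * poly ?r y * weight d1 d2 u v x y)" for x y
    unfolding weight_def potential_eq_poly
    by (rule DERIV_imp_deriv) (auto intro!: derivative_eq_intros simp: algebra_simps)
  have "iterated_integrable \<Gamma>x \<Gamma>y (\<lambda>x y. (- 1) * (poly p x * poly ?r y * weight d1 d2 u v x y))"
    using convergent[of "- p" ?r] by simp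
  from iterated_integral_add[OF convergent[of "pCons 0 p" q] this]
  show ?thesis
    using by_parts_y[of p q] unfolding deriv iterated_integral_lmul[OF convergent[of p ?r]]
    by (simp add: pairing_def)
qed

end

text \<open>Put \<open>m = n - d2\<close>. Pairing the expansion of \<open>x \<psi> n\<close> with
  \<open>\<sigma> m\<close> isolates the coefficient. Integration by parts replaces \<open>x\<close>
  by \<open>V2'\<close> acting on \<open>\<sigma> m\<close>; the result has degree \<open>n\<close>
  and leading coefficient \<open>v (d2 + 1)\<close>, and only this coefficient is seen by
  \<open>\<pi> n\<close>. The ratio of values of \<open>g\<close> is the product of the \<gamma> in
  telescoped form.\<close>

lemma alpha_top:
  fixes u v :: "nat \<Rightarrow> complex" and \<pi> \<sigma> :: "nat \<Rightarrow> complex poly" and g h :: "nat \<Rightarrow> complex"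
  assumes v: "v (d2 + 1) \<noteq> 0"
    and convergent: "\<And>p q :: complex poly. iterated_integrable \<Gamma>x \<Gamma>y
          (\<lambda>x y. poly p x * poly q y * weight d1 d2 u v x y)"
    and by_parts_y: "\<And>p q :: complex poly. iterated_integral \<Gamma>x \<Gamma>y
          (\<lambda>x y. deriv (\<lambda>y. poly p x * poly q y * weight d1 d2 u v x y) y) = 0"
    and \<sigma>: "\<And>n. degree (\<sigma> n) = n" "\<And>n. lead_coeff (\<sigma> n) = 1"
    and biorthogonal: "\<And>n m. iterated_integral \<Gamma>x \<Gamma>y
          (\<lambda>x y. poly (\<pi> n) x * poly (\<sigma> m) y * weight d1 d2 u v x y) =
          (if n = m then h n else 0)"
    and h: "\<And>n. h n \<noteq> 0" and g: "\<And>n. (g n)\<^sup>2 = h n"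
    and psi: "\<And>n x. \<psi> n x = poly (\<pi> n) x * exp (- potential d1 u x) / g n"
    and recursion_x: "\<And>n x. x * \<psi> n x =
          (\<Sum>j\<in>{j \<in> {- 1..int d2}. int n - j \<ge> 0}. \<alpha> j n * \<psi> (nat (int n - j)) x)"
    and n: "d2 \<le> n"
  shows "\<alpha> (int d2) n = v (d2 + 1) * (g n / g (n - d2))"
proof -
  define m where "m = n - d2"
  define B where "B = pairing d1 d2 u v \<Gamma>x \<Gamma>y"
  define S where "S = {j \<in> {- 1..int d2}. int n - j \<ge> 0}"
  have "finite S"
    unfolding S_def by (rule finite_subset[of _ "{- 1..int d2}"]) auto
  have g0: "g k \<noteq> 0" for k using g[of k] h[of k] by auto
  interpret left: linear_functional "\<lambda>p. B p q" for q
    unfolding B_def by (rule linear_functional_pairing_left[OF convergent])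
  interpret right: linear_functional "B p" for p
    unfolding B_def by (rule linear_functional_pairing_right[OF convergent])
  have B: "B (\<pi> i) (\<sigma> k) = (if i = k then h i else 0)" for i k
    unfolding B_def pairing_def by (rule biorthogonal)
  define P where "P k = Polynomial.smult (1 / g k) (\<pi> k)" for k
  have BP: "B (P k) (\<sigma> m) = (if k = m then g m else 0)" for k
    using g0[of m] by (simp add: P_def left.smult B g[symmetric] power2_eq_square)
  \<comment> \<open>The exponential never vanishes, so dividing it out turns the recursion for
    \<psi> into an identity of polynomials.\<close>
  have "poly (pCons 0 (P n)) = poly (\<Sum>j\<in>S. Polynomial.smult (\<alpha> j n) (P (nat (int n - j))))"
  proof
    fix x
    have \<psi>: "\<psi> k x = poly (P k) x * exp (- potential d1 u x)" for k
      by (simp add: psi P_def)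
    have "poly (pCons 0 (P n)) x * exp (- potential d1 u x) =
      poly (\<Sum>j\<in>S. Polynomial.smult (\<alpha> j n) (P (nat (int n - j)))) x * exp (- potential d1 u x)"
      using recursion_x[of x n] unfolding \<psi> S_def[symmetric]
      by (simp add: poly_sum sum_distrib_left mult_ac)
    then show "poly (pCons 0 (P n)) x =
        poly (\<Sum>j\<in>S. Polynomial.smult (\<alpha> j n) (P (nat (int n - j)))) x" by simp
  qed
  then have "pCons 0 (P n) = (\<Sum>j\<in>S. Polynomial.smult (\<alpha> j n) (P (nat (int n - j))))"
    by (simp only: poly_eq_poly_eq_iff)
  then have "B (pCons 0 (P n)) (\<sigma> m) = (\<Sum>j\<in>S. \<alpha> j n * B (P (nat (int n - j))) (\<sigma> m))"
    by (simp only: left.sum left.smult)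
  also have "\<dots> = (\<Sum>j\<in>S. if j = int d2 then \<alpha> (int d2) n * g m else 0)"
  proof (rule sum.cong)
    fix j assume "j \<in> S"
    then have "nat (int n - j) = m \<longleftrightarrow> j = int d2"
      using n by (auto simp: S_def m_def)
    then show "\<alpha> j n * B (P (nat (int n - j))) (\<sigma> m) =
        (if j = int d2 then \<alpha> (int d2) n * g m else 0)"
      unfolding BP by (simp only: if_distrib[of "(*) _"] mult_zero_right cong: if_cong)
  qed simp
  also have "\<dots> = \<alpha> (int d2) n * g m"
    using \<open>finite S\<close> n by (simp add: S_def)
  finally have "\<alpha> (int d2) n * g m = B (pCons 0 (P n)) (\<sigma> m)" ..
  also have "\<dots> = 1 / g n * B (pCons 0 (\<pi> n)) (\<sigma> m)"
    using left.smult[of "1 / g n" "pCons 0 (\<pi> n)" "\<sigma> m"] by (simp add: P_def)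
  also have "B (pCons 0 (\<pi> n)) (\<sigma> m) =
      B (\<pi> n) (\<sigma> m * pderiv (potential_poly d2 v) - pderiv (\<sigma> m))"
    unfolding B_def by (rule pairing_mult_x[OF convergent by_parts_y])
  also have "\<dots> = v (d2 + 1) * h n"
  proof -
    let ?q = "\<sigma> m * pderiv (potential_poly d2 v) - pderiv (\<sigma> m)"
    have "degree (\<sigma> m * pderiv (potential_poly d2 v)) \<le> n"
      using degree_mult_le[of "\<sigma> m" "pderiv (potential_poly d2 v)"]
        degree_pderiv_potential_poly[of v d2, OF v] \<sigma>(1)[of m] n by (simp add: m_def)
    moreover have "degree (pderiv (\<sigma> m)) \<le> n"
      using \<sigma>(1)[of m] by (simp add: degree_pderiv m_def)
    ultimately have "degree ?q \<le> n" by (rule degree_diff_le)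
    then have "B (\<pi> n) ?q = coeff ?q n * B (\<pi> n) (\<sigma> n)"
      by (intro right.eq_top_coeff \<sigma>) (simp_all add: B)
    moreover have "coeff (\<sigma> m * pderiv (potential_poly d2 v)) n = v (d2 + 1)"
      using coeff_mult_pderiv_potential_poly[of v d2 "\<sigma> m", OF v] \<sigma>[of m] n by (simp add: m_def)
    moreover have "coeff (pderiv (\<sigma> m)) n = 0"
      using \<sigma>(1)[of m] by (simp add: coeff_pderiv coeff_eq_0 m_def)
    ultimately show ?thesis by (simp add: B)
  qed
  also have "1 / g n * (v (d2 + 1) * h n) = v (d2 + 1) * g n"
    using g0[of n] by (simp add: g[symmetric] power2_eq_square)
  finally show ?thesis
    using g0[of m] by (simp add: m_def field_simps)
qed

text \<open>Dividing the formula for the derivative of \<open>\<psi> m\<close>,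
  \<open>m = n - d1\<close>, by the exponential gives a polynomial identity; the claim compares its
  coefficients of \<open>x ^ n\<close>.\<close>

lemma beta_top:
  fixes u :: "nat \<Rightarrow> complex" and \<pi> :: "nat \<Rightarrow> complex poly" and g :: "nat \<Rightarrow> complex"
  assumes u: "u (d1 + 1) \<noteq> 0"
    and \<pi>: "\<And>n. degree (\<pi> n) = n" "\<And>n. lead_coeff (\<pi> n) = 1"
    and g: "\<And>n. g n \<noteq> 0"
    and psi: "\<And>n x. \<psi> n x = poly (\<pi> n) x * exp (- potential d1 u x) / g n"
    and recursion_deriv: "\<And>n x. deriv (\<psi> n) x =
          - (\<Sum>j\<in>{j \<in> {- 1..int d1}. int n + j \<ge> 0}.
               \<beta> j (nat (int n + j)) * \<psi> (nat (int n + j)) x)"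
    and n: "d1 \<le> n"
  shows "\<beta> (int d1) n = u (d1 + 1) * (g n / g (n - d1))"
proof -
  define m where "m = n - d1"
  define S where "S = {j \<in> {- 1..int d1}. int m + j \<ge> 0}"
  have "finite S"
    unfolding S_def by (rule finite_subset[of _ "{- 1..int d1}"]) auto
  define P where "P k = Polynomial.smult (1 / g k) (\<pi> k)" for k
  let ?W = "potential_poly d1 u"
  have \<psi>: "\<psi> k = (\<lambda>x. poly (P k) x * exp (- poly ?W x))" for k
    by (rule ext) (simp add: psi P_def potential_eq_poly)
  have P: "degree (P k) = k" "coeff (P k) k = 1 / g k" for k
    using \<pi>[of k] g[of k] by (simp_all add: P_def)
  have "poly (P m * pderiv ?W - pderiv (P m)) =
      poly (\<Sum>j\<in>S. Polynomial.smult (\<beta> j (nat (int m + j))) (P (nat (int m + j))))"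
  proof
    fix x
    have deriv: "deriv (\<psi> m) x = - (poly (P m * pderiv ?W - pderiv (P m)) x * exp (- poly ?W x))"
      unfolding \<psi>
      by (rule DERIV_imp_deriv) (auto intro!: derivative_eq_intros simp: algebra_simps)
    have "poly (P m * pderiv ?W - pderiv (P m)) x * exp (- poly ?W x) =
        (\<Sum>j\<in>S. \<beta> j (nat (int m + j)) * \<psi> (nat (int m + j)) x)"
      using recursion_deriv[of m x] unfolding deriv S_def by (simp only: neg_equal_iff_equal)
    also have "\<dots> = poly (\<Sum>j\<in>S. Polynomial.smult (\<beta> j (nat (int m + j))) (P (nat (int m + j)))) x *
        exp (- poly ?W x)"
      by (simp add: \<psi> poly_sum sum_distrib_left mult_ac)
    finally show "poly (P m * pderiv ?W - pderiv (P m)) x =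
        poly (\<Sum>j\<in>S. Polynomial.smult (\<beta> j (nat (int m + j))) (P (nat (int m + j)))) x" by simp
  qed
  then have eq: "P m * pderiv ?W - pderiv (P m) =
      (\<Sum>j\<in>S. Polynomial.smult (\<beta> j (nat (int m + j))) (P (nat (int m + j))))"
    by (simp only: poly_eq_poly_eq_iff)
  have "coeff (P m * pderiv ?W) n = 1 / g m * u (d1 + 1)"
    using coeff_mult_pderiv_potential_poly[of u d1 "P m", OF u] P[of m] n by (simp add: m_def)
  moreover have "coeff (pderiv (P m)) n = 0"
    using P(1)[of m] by (simp add: coeff_pderiv coeff_eq_0 m_def)
  ultimately have "1 / g m * u (d1 + 1) = coeff (P m * pderiv ?W - pderiv (P m)) n"
    by simp
  also have "\<dots> = (\<Sum>j\<in>S. \<beta> j (nat (int m + j)) * coeff (P (nat (int m + j))) n)"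
    unfolding eq by (simp add: coeff_sum)
  \<comment> \<open>Among the polynomials in the expansion only the one with \<open>j = d1\<close>
    reaches degree \<open>n\<close>.\<close>
  also have "\<dots> = (\<Sum>j\<in>S. if j = int d1 then \<beta> (int d1) n * (1 / g n) else 0)"
  proof (rule sum.cong)
    fix j assume j: "j \<in> S"
    show "\<beta> j (nat (int m + j)) * coeff (P (nat (int m + j))) n =
        (if j = int d1 then \<beta> (int d1) n * (1 / g n) else 0)"
    proof (cases "j = int d1")
      case True
      then have "nat (int m + j) = n" using n by (simp add: m_def)
      then show ?thesis using True P(2)[of n] by simp
    next
      case False
      then have "nat (int m + j) < n" using j n by (auto simp: S_def m_def)
      then show ?thesis using False P(1)[of "nat (int m + j)"] by (simp add: coeff_eq_0)
    qed
  qed simp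
  also have "\<dots> = \<beta> (int d1) n * (1 / g n)"
    using \<open>finite S\<close> by (simp add: S_def)
  finally show ?thesis
    using g[of m] g[of n] by (simp add: m_def field_simps)
qed

section \<open>The two pairs of spectral curves\<close>

theorem proposition4p1:
  fixes d1 d2 :: nat
    and u v :: "nat \<Rightarrow> complex"
    and \<Gamma>x \<Gamma>y :: "real \<Rightarrow> complex"
    and \<pi> \<sigma> :: "nat \<Rightarrow> complex poly"
    and h sqrt_h \<gamma> :: "nat \<Rightarrow> complex"
    and \<psi> :: "nat \<Rightarrow> complex \<Rightarrow> complex"
    and \<alpha> \<beta> :: "int \<Rightarrow> nat \<Rightarrow> complex"
  assumes d: "d1 \<ge> 1" "d2 \<ge> 1"
    and leading: "u (d1 + 1) \<noteq> 0" "v (d2 + 1) \<noteq> 0"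
    and contours: "contour \<Gamma>x" "contour \<Gamma>y"
    and convergent: "\<And>p q :: complex poly. iterated_integrable \<Gamma>x \<Gamma>y
          (\<lambda>x y. poly p x * poly q y * weight d1 d2 u v x y)"
    and by_parts_x: "\<And>p q :: complex poly. iterated_integral \<Gamma>x \<Gamma>y
          (\<lambda>x y. deriv (\<lambda>x. poly p x * poly q y * weight d1 d2 u v x y) x) = 0"
    and by_parts_y: "\<And>p q :: complex poly. iterated_integral \<Gamma>x \<Gamma>y
          (\<lambda>x y. deriv (\<lambda>y. poly p x * poly q y * weight d1 d2 u v x y) y) = 0"
    and monic_pi: "\<And>n. degree (\<pi> n) = n" "\<And>n. lead_coeff (\<pi> n) = 1"
    and monic_sigma: "\<And>n. degree (\<sigma> n) = n" "\<And>n. lead_coeff (\<sigma> n) = 1"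
    and biorthogonal: "\<And>n m. iterated_integral \<Gamma>x \<Gamma>y
          (\<lambda>x y. poly (\<pi> n) x * poly (\<sigma> m) y * weight d1 d2 u v x y) =
          (if n = m then h n else 0)"
    and h_nonzero: "\<And>n. h n \<noteq> 0"
    and sqrt_h: "\<And>n. (sqrt_h n)\<^sup>2 = h n"
    and psi: "\<And>n x. \<psi> n x = poly (\<pi> n) x * exp (- potential d1 u x) / sqrt_h n"
    and gamma: "\<And>n. \<gamma> n = sqrt_h (n + 1) / sqrt_h n"
    and alpha_gamma: "\<And>n. \<alpha> (- 1) n = \<gamma> n"
    and beta_gamma: "\<And>n. \<beta> (- 1) n = \<gamma> n"
    and alpha_zero: "\<And>j n. j \<in> {- 1..int d2} \<Longrightarrow> int n < j \<Longrightarrow> \<alpha> j n = 0"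
    and beta_zero: "\<And>j n. j \<in> {- 1..int d1} \<Longrightarrow> int n < j \<Longrightarrow> \<beta> j n = 0"
    and recursion_x: "\<And>n x. x * \<psi> n x =
          (\<Sum>j\<in>{j \<in> {- 1..int d2}. int n - j \<ge> 0}. \<alpha> j n * \<psi> (nat (int n - j)) x)"
    and recursion_deriv: "\<And>n x. deriv (\<psi> n) x =
          - (\<Sum>j\<in>{j \<in> {- 1..int d1}. int n + j \<ge> 0}.
               \<beta> j (nat (int n + j)) * \<psi> (nat (int n + j)) x)"
  shows "(\<forall>N \<ge> d1 + 1.
            cst (u (d1 + 1)) * Determinant.det (X \<cdot>\<^sub>m 1\<^sub>m (d1 + 1) - D2 d1 d2 \<alpha> \<beta> \<gamma> N Y) =
            cst (v (d2 + 1)) * Determinant.det (Y \<cdot>\<^sub>m 1\<^sub>m (d2 + 1) - uD1 d1 d2 \<alpha> \<beta> \<gamma> N X)) \<and>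
         (\<forall>N \<ge> d2 + 1.
            cst (u (d1 + 1)) * Determinant.det (X \<cdot>\<^sub>m 1\<^sub>m (d1 + 1) - uD2 d1 d2 \<alpha> \<beta> \<gamma> N Y) =
            cst (v (d2 + 1)) * Determinant.det (Y \<cdot>\<^sub>m 1\<^sub>m (d2 + 1) - D1 d1 d2 \<alpha> \<beta> \<gamma> N X))"
proof -
  have g: "sqrt_h n \<noteq> 0" for n
    using sqrt_h[of n] h_nonzero[of n] by auto
  have \<gamma>: "\<gamma> n = sqrt_h (n + 1) / sqrt_h n" for n
    by (rule gamma)
  have \<alpha>: "\<alpha> (int d2) n = v (d2 + 1) * (sqrt_h n / sqrt_h (n - d2))" if "d2 \<le> n" for n
    by (rule alpha_top[OF leading(2) convergent by_parts_y monic_sigma biorthogonal h_nonzero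
          sqrt_h psi recursion_x that])
  have \<beta>: "\<beta> (int d1) n = u (d1 + 1) * (sqrt_h n / sqrt_h (n - d1))" if "d1 \<le> n" for n
    by (rule beta_top[OF leading(1) monic_pi g psi recursion_deriv that])
  show ?thesis
  proof (intro conjI allI impI)
    fix N assume "d1 + 1 \<le> N"
    then show "cst (u (d1 + 1)) * Determinant.det (X \<cdot>\<^sub>m 1\<^sub>m (d1 + 1) - D2 d1 d2 \<alpha> \<beta> \<gamma> N Y) =
        cst (v (d2 + 1)) * Determinant.det (Y \<cdot>\<^sub>m 1\<^sub>m (d2 + 1) - uD1 d1 d2 \<alpha> \<beta> \<gamma> N X)"
      unfolding D2_def uD1_def
      \<comment> \<open>Here \<beta> enters through the ladder matrices, so \<kappa> is
        \<open>u (d1 + 1)\<close> and \<kappa>' is \<open>v (d2 + 1)\<close>.\<close>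
      by (rule spectral_duality[where g = sqrt_h])
        (use d g \<gamma> alpha_gamma beta_gamma \<alpha> \<beta> leading in simp_all)
  next
    fix N assume "d2 + 1 \<le> N"
    then show "cst (u (d1 + 1)) * Determinant.det (X \<cdot>\<^sub>m 1\<^sub>m (d1 + 1) - uD2 d1 d2 \<alpha> \<beta> \<gamma> N Y) =
        cst (v (d2 + 1)) * Determinant.det (Y \<cdot>\<^sub>m 1\<^sub>m (d2 + 1) - D1 d1 d2 \<alpha> \<beta> \<gamma> N X)"
      unfolding D1_def uD2_def
      \<comment> \<open>Now \<alpha> enters through the ladder matrices, so \<kappa> and \<kappa>'
        trade places and the equation is read backwards.\<close>
      by (intro sym[OF spectral_duality[where g = sqrt_h]])
        (use d g \<gamma> alpha_gamma beta_gamma \<alpha> \<beta> leading in simp_all)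
  qed
qed

end
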